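(* Suppose $n$ is even, $z\in I_n^{\mathsf{FPF}}$, and $D\subseteq[n]\times[n]$. The following are equivalent: (a) Some reading word of $D$ is an fpf-involution word for $z$. (b) Every reading word of $D$ is an fpf-involution word for $z$. (c) The set $D$ is a reduced pipe dream for some fpf-atom of $z$. Moreover, if $D\subseteq\{(j,i)\in[n]\times[n]:i<j\}$, then $D\in\mathcal{FD}(z)$ if and only if these equivalent conditions hold.
   Context: $n$ is a positive integer, $[n]=\{1,\dots,n\}$; $S_n$ is the group of permutations of $\mathbb Z_{>0}$ fixing all $i>n$, $s_i=(i,i+1)$, $\ell$ is Coxeter length. $I_n^{\mathsf{FPF}}$ is the set of $z\in S_n$ with $z=z^{-1}$ and $z(i)\ne i$ for all $i\in[n]$. **Fpf-involution words and fpf-atoms.** Put $1^{\mathsf{FPF}}_n=s_1s_3\cdots s_{n-1}$. An fpf-involution word for $z$ is a minimal-length word $a_1\cdots a_l$ with letters in $[n-1]$ and $z=s_{a_l}\cdots s_{a_1}1^{\mathsf{FPF}}_ns_{a_1}\cdots s_{a_l}$. An fpf-atom for $z$ is a minimal-length $w\in S_n$ with $z=w^{-1}1^{\mathsf{FPF}}_nw$. **Reading words.** Let $\le_{\mathsf{NE}}$ be the partial order on $[n]\times[n]$ with $(i,j)\le_{\mathsf{NE}}(i',j')$ iff $i\le i'$ and $j\ge j'$. A reading order is a linear extension of it, i.e. a bijection $\omega:[n]\times[n]\to[n^2]$ with $\omega(s)<\omega(t)$ whenever $s<_{\mathsf{NE}}t$. If $\omega(D)=\{i_1<\cdots<i_m\}$,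 the associated reading word of $D$ is $a_1\cdots a_m$ where $a_k=p+q-1$ for $(p,q)=\omega^{-1}(i_k)$. **Pipe dreams.** Positions $(i,j)$ are in matrix coordinates. For $D\subseteq\{(i,j)\in[n]\times[n]:i+j\le n\}$ the wiring diagram of $D$ is drawn as follows: in a cell $(i,j)\in D$ one path joins the left edge to the right edge and another joins the bottom edge to the top edge (they cross); in a cell $(i,j)\notin D$ with $i+j\le n$ one path joins left to top and another joins bottom to right; in a cell with $i+j=n+1$ a single path joins left to top. Connecting these gives $n$ pipes. $D$ is a reduced pipe dream if no two pipes cross more than once; it is a reduced pipe dream for $w\in S_n$ if, labeling left endpoints $1,\dots,n$ from top to bottom and top endpoints $1,\dots,n$ from left to right, the pipe with left endpoint $i$ has top endpoint $w(i)$ for each $i$. $\mathcal{PD}(w)$ is the set of these. $D$ is symmetric if $(i,j)\in D$ implies $(j,i)\in D$. Finally, $\mathcal{FD}(z)=\{D\cap\{(j,i)\in[n]\times[n]:i<j\}:D\in\mathcal{PD}(z)\text{ symmetric}\}$. *)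

theory Defs
  imports "HOL-Combinatorics.Permutations"
begin

text \<open>
  The group \<open>S\<^sub>n\<close> is rendered by \<open>w permutes {1..n}\<close> for \<open>w :: nat \<Rightarrow> nat\<close> (so \<open>0\<close> is fixed
  as well), and products are composed as functions, from right to left.
\<close>

definition simple_transp :: "nat \<Rightarrow> nat \<Rightarrow> nat" where
  "simple_transp i = transpose i (i + 1)"

text \<open>The product \<open>s\<^bsub>a_1\<^esub> \<cdots> s\<^bsub>a_l\<^esub>\<close> for the word \<open>[a_1, \<dots>, a_l]\<close>.\<close>

definition word_perm :: "nat list \<Rightarrow> nat \<Rightarrow> nat" where
  "word_perm a = foldr (\<lambda>i f. simple_transp i \<circ> f) a id"

definition coxeter_length :: "nat \<Rightarrow> (nat \<Rightarrow> nat) \<Rightarrow> nat" where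
  "coxeter_length n w = (LEAST l. \<exists>a. set a \<subseteq> {1..n - 1} \<and> length a = l \<and> w = word_perm a)"

definition fpf_involutions :: "nat \<Rightarrow> (nat \<Rightarrow> nat) set" where
  "fpf_involutions n = {z. z permutes {1..n} \<and> z = inv z \<and> (\<forall>i\<in>{1..n}. z i \<noteq> i)}"

text \<open>For even \<open>n\<close> this is \<open>s\<^sub>1 s\<^sub>3 \<cdots> s\<^bsub>n-1\<^esub>\<close>.\<close>

definition one_fpf :: "nat \<Rightarrow> nat \<Rightarrow> nat" where
  "one_fpf n = word_perm (filter odd [1..<n])"

definition fpf_involution_word :: "nat \<Rightarrow> (nat \<Rightarrow> nat) \<Rightarrow> nat list \<Rightarrow> bool" where
  "fpf_involution_word n z a \<longleftrightarrow>
     is_arg_min length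
       (\<lambda>b. set b \<subseteq> {1..n - 1} \<and> z = word_perm (rev b) \<circ> one_fpf n \<circ> word_perm b) a"

definition fpf_atom :: "nat \<Rightarrow> (nat \<Rightarrow> nat) \<Rightarrow> (nat \<Rightarrow> nat) \<Rightarrow> bool" where
  "fpf_atom n z w \<longleftrightarrow>
     is_arg_min (coxeter_length n)
       (\<lambda>v. v permutes {1..n} \<and> z = inv v \<circ> one_fpf n \<circ> v) w"

definition le_NE :: "nat \<times> nat \<Rightarrow> nat \<times> nat \<Rightarrow> bool" where
  "le_NE s t \<longleftrightarrow> fst s \<le> fst t \<and> snd s \<ge> snd t"

definition reading_order :: "nat \<Rightarrow> (nat \<times> nat \<Rightarrow> nat) \<Rightarrow> bool" where
  "reading_order n \<omega> \<longleftrightarrow>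
     bij_betw \<omega> ({1..n} \<times> {1..n}) {1..n\<^sup>2} \<and>
     (\<forall>s\<in>{1..n} \<times> {1..n}. \<forall>t\<in>{1..n} \<times> {1..n}. le_NE s t \<and> s \<noteq> t \<longrightarrow> \<omega> s < \<omega> t)"

definition reading_word_of :: "nat \<Rightarrow> (nat \<times> nat \<Rightarrow> nat) \<Rightarrow> (nat \<times> nat) set \<Rightarrow> nat list" where
  "reading_word_of n \<omega> D =
     map (\<lambda>k. let (p, q) = inv_into ({1..n} \<times> {1..n}) \<omega> k in p + q - 1)
       (sorted_list_of_set (\<omega> ` D))"

definition reading_word :: "nat \<Rightarrow> (nat \<times> nat) set \<Rightarrow> nat list \<Rightarrow> bool" where
  "reading_word n D a \<longleftrightarrow> (\<exists>\<omega>. reading_order n \<omega> \<and> a = reading_word_of n \<omega> D)"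

text \<open>
  The unit edges of the grid: \<open>Left_Edge i j\<close> and \<open>Top_Edge i j\<close> are the left and the top edge of
  the cell in row \<open>i\<close> and column \<open>j\<close>. Thus the right edge of cell \<open>(i, j)\<close> is
  \<open>Left_Edge i (j + 1)\<close> and its bottom edge is \<open>Top_Edge (i + 1) j\<close>.
\<close>

datatype edge = Left_Edge nat nat | Top_Edge nat nat

text \<open>
  The path segments of the wiring diagram, each one joining two edges of a single cell. They are
  directed so that every pipe is traversed from its left endpoint to its top endpoint.
\<close>

inductive wire :: "nat \<Rightarrow> (nat \<times> nat) set \<Rightarrow> edge \<Rightarrow> edge \<Rightarrow> bool"
  for n :: nat and D :: "(nat \<times> nat) set" where
  cross_horizontal:
    "1 \<le> i \<Longrightarrow> 1 \<le> j \<Longrightarrow> i + j \<le> n \<Longrightarrow> (i, j) \<in> D \<Longrightarrow>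
       wire n D (Left_Edge i j) (Left_Edge i (j + 1))"
| cross_vertical:
    "1 \<le> i \<Longrightarrow> 1 \<le> j \<Longrightarrow> i + j \<le> n \<Longrightarrow> (i, j) \<in> D \<Longrightarrow>
       wire n D (Top_Edge (i + 1) j) (Top_Edge i j)"
| bump_left_top:
    "1 \<le> i \<Longrightarrow> 1 \<le> j \<Longrightarrow> i + j \<le> n \<Longrightarrow> (i, j) \<notin> D \<Longrightarrow>
       wire n D (Left_Edge i j) (Top_Edge i j)"
| bump_bottom_right:
    "1 \<le> i \<Longrightarrow> 1 \<le> j \<Longrightarrow> i + j \<le> n \<Longrightarrow> (i, j) \<notin> D \<Longrightarrow>
       wire n D (Top_Edge (i + 1) j) (Left_Edge i (j + 1))"
| diagonal_turn:
    "1 \<le> i \<Longrightarrow> 1 \<le> j \<Longrightarrow> i + j = n + 1 \<Longrightarrow>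
       wire n D (Left_Edge i j) (Top_Edge i j)"

text \<open>The set of edges met by the pipe whose left endpoint is labeled \<open>p\<close>.\<close>

definition pipe :: "nat \<Rightarrow> (nat \<times> nat) set \<Rightarrow> nat \<Rightarrow> edge set" where
  "pipe n D p = {e. (wire n D)\<^sup>*\<^sup>* (Left_Edge p 1) e}"

definition crossings :: "nat \<Rightarrow> (nat \<times> nat) set \<Rightarrow> nat \<Rightarrow> nat \<Rightarrow> (nat \<times> nat) set" where
  "crossings n D p q =
     {(i, j) \<in> D.
        Left_Edge i j \<in> pipe n D p \<and> Top_Edge (i + 1) j \<in> pipe n D q \<or>
        Left_Edge i j \<in> pipe n D q \<and> Top_Edge (i + 1) j \<in> pipe n D p}"

definition reduced_pipe_dream :: "nat \<Rightarrow> (nat \<times> nat) set \<Rightarrow> bool" where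
  "reduced_pipe_dream n D \<longleftrightarrow>
     D \<subseteq> {(i, j) \<in> {1..n} \<times> {1..n}. i + j \<le> n} \<and>
     (\<forall>p\<in>{1..n}. \<forall>q\<in>{1..n}. p \<noteq> q \<longrightarrow> card (crossings n D p q) \<le> 1)"

definition PD :: "nat \<Rightarrow> (nat \<Rightarrow> nat) \<Rightarrow> (nat \<times> nat) set set" where
  "PD n w = {D. reduced_pipe_dream n D \<and> (\<forall>i\<in>{1..n}. Top_Edge 1 (w i) \<in> pipe n D i)}"

definition strictly_lower :: "nat \<Rightarrow> (nat \<times> nat) set" where
  "strictly_lower n = {(j, i) \<in> {1..n} \<times> {1..n}. i < j}"

definition FD :: "nat \<Rightarrow> (nat \<Rightarrow> nat) \<Rightarrow> (nat \<times> nat) set set" where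
  "FD n z = {D \<inter> strictly_lower n |D. D \<in> PD n z \<and> sym D}"

end

theory Submission
  imports Defs
begin

text \<open>
  A word is reduced iff no two strands cross twice in its wiring diagram, because the inversions of
  its product are the pairs that cross an odd number of times. Any two reading words of \<open>D\<close> differ
  by commutations, and the pipes of \<open>D\<close> are the strands of a reading word. So \<open>D\<close> is a reduced pipe
  dream for \<open>w\<close> iff its reading words are reduced words for \<open>w\<close>, and fpf-involution words are the
  reduced words of fpf-atoms.

  For the last part, order the cells of a symmetric \<open>E\<close> by descending \<open>j - i\<close>: a reading word of \<open>E\<close>
  has the form \<open>rev b @ d @ b\<close>, with \<open>b\<close> a reading word of the strictly lower part and \<open>d\<close> consisting of
  the distinct odd letters of the diagonal cells. If one of the letters \<open>1, 3, \<dots>, n - 1\<close> is missing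
  from \<open>d\<close>, then the product has a fixed point in \<open>{1..n}\<close>; so for fpf \<open>z\<close> the product of \<open>d\<close> is \<open>one_fpf n\<close>.
  Conjugating at a descent \<open>p\<close> with \<open>z p \<noteq> p + 1\<close> lowers the length by two, and only \<open>one_fpf n\<close> has no
  such descent. Hence \<open>b\<close> has minimal length iff \<open>rev b @ d @ b\<close> is reduced.
\<close>

section \<open>Inversions and reduced words\<close>

lemma word_perm_Nil [simp]: "word_perm [] = id"
  by (simp add: word_perm_def)

lemma word_perm_Cons [simp]: "word_perm (p # a) = simple_transp p \<circ> word_perm a"
  by (simp add: word_perm_def)

lemma word_perm_append [simp]: "word_perm (a @ b) = word_perm a \<circ> word_perm b"
  by (induction a) (simp_all add: o_assoc)

lemma simple_transp_involutory [simp]: "simple_transp p (simple_transp p x) = x"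
  by (simp add: simple_transp_def)

lemma simple_transp_comp_self [simp]: "simple_transp p \<circ> simple_transp p = id"
  by (simp add: fun_eq_iff)

lemma simple_transp_apply:
  "simple_transp p x = (if x = p then Suc p else if x = Suc p then p else x)"
  by (simp add: simple_transp_def transpose_def)

lemma word_perm_rev_comp [simp]: "word_perm (rev a) \<circ> word_perm a = id"
proof (induction a)
  case (Cons p a)
  have "word_perm (rev (p # a)) \<circ> word_perm (p # a)
      = word_perm (rev a) \<circ> (simple_transp p \<circ> simple_transp p) \<circ> word_perm a"
    by (simp add: fun_eq_iff)
  with Cons show ?case by simp
qed simp

lemma word_perm_comp_rev [simp]: "word_perm a \<circ> word_perm (rev a) = id"
  using word_perm_rev_comp[of "rev a"] by simp

lemma word_perm_rev_apply [simp]: "word_perm a (word_perm (rev a) x) = x"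
  by (metis comp_apply id_apply word_perm_comp_rev)

lemma bij_word_perm: "bij (word_perm a)"
  by (rule o_bij[OF word_perm_rev_comp word_perm_comp_rev])

lemma inv_word_perm: "inv (word_perm a) = word_perm (rev a)"
  by (rule inv_unique_comp[OF word_perm_comp_rev word_perm_rev_comp])

lemma simple_transp_permutes: "p \<in> {1..n - 1} \<Longrightarrow> simple_transp p permutes {1..n}"
  unfolding simple_transp_def by (rule permutes_swap_id) auto

lemma word_perm_permutes: "set a \<subseteq> {1..n - 1} \<Longrightarrow> word_perm a permutes {1..n}"
proof (induction a)
  case (Cons p a)
  then have "word_perm a permutes {1..n}" and "simple_transp p permutes {1..n}"
    using simple_transp_permutes by auto
  then show ?case using permutes_compose by (subst word_perm_Cons) blast
qed (simp add: permutes_id id_def[symmetric])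

lemma word_perm_fixes: "\<forall>q\<in>set a. x \<noteq> q \<and> x \<noteq> Suc q \<Longrightarrow> word_perm a x = x"
  by (induction a) (auto simp: simple_transp_apply)

text \<open>Inversions are named by their values, not by their positions: right multiplication by an
  adjacent transposition permutes positions only, so exactly one pair enters or leaves the
  set.\<close>

definition inversion_pairs :: "(nat \<Rightarrow> nat) \<Rightarrow> nat set set" where
  "inversion_pairs u = {{u i, u j} |i j. i < j \<and> u j < u i}"

lemma inversion_pairs_iff:
  assumes "inj u" "i < j"
  shows "{u i, u j} \<in> inversion_pairs u \<longleftrightarrow> u j < u i"
  using assms by (auto simp: inversion_pairs_def doubleton_eq_iff inj_eq)

lemma inversion_pairs_id [simp]: "inversion_pairs id = {}" "inversion_pairs (\<lambda>x. x) = {}"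
  by (auto simp: inversion_pairs_def)

lemma simple_transp_less:
  "i < j \<Longrightarrow> (i, j) \<noteq> (p, Suc p) \<Longrightarrow> simple_transp p i < simple_transp p j"
  by (auto simp: simple_transp_apply)

text \<open>\<open>simple_transp p\<close> keeps the relative order of every two positions other
  than \<open>p\<close> and \<open>Suc p\<close>, so all other pairs of values keep their
  status.\<close>

lemma inversion_pairs_ascent:
  assumes u: "inj u" and asc: "u p < u (Suc p)"
  shows "inversion_pairs (u \<circ> simple_transp p) = insert {u p, u (Suc p)} (inversion_pairs u)"
    and "{u p, u (Suc p)} \<notin> inversion_pairs u"
proof -
  let ?s = "simple_transp p"
  show "{u p, u (Suc p)} \<notin> inversion_pairs u"
    using inversion_pairs_iff[OF u, of p "Suc p"] asc by simp
  show "inversion_pairs (u \<circ> ?s) = insert {u p, u (Suc p)} (inversion_pairs u)"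
  proof (intro equalityI subsetI)
    fix X assume "X \<in> inversion_pairs (u \<circ> ?s)"
    then obtain i j where ij: "i < j" "u (?s j) < u (?s i)" "X = {u (?s i), u (?s j)}"
      by (auto simp: inversion_pairs_def)
    show "X \<in> insert {u p, u (Suc p)} (inversion_pairs u)"
    proof (cases "(i, j) = (p, Suc p)")
      case True
      then show ?thesis using ij by (auto simp: simple_transp_apply)
    next
      case False
      from simple_transp_less[OF ij(1) False] ij(2,3) show ?thesis
        by (auto simp: inversion_pairs_def)
    qed
  next
    fix X assume "X \<in> insert {u p, u (Suc p)} (inversion_pairs u)"
    then consider "X = {u p, u (Suc p)}"
      | i j where "i < j" "u j < u i" "X = {u i, u j}"
      by (auto simp: inversion_pairs_def)
    then show "X \<in> inversion_pairs (u \<circ> ?s)"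
    proof cases
      case 1
      then show ?thesis using asc unfolding inversion_pairs_def
        by (intro CollectI exI[of _ p] exI[of _ "Suc p"]) (auto simp: simple_transp_apply)
    next
      case 2
      then have "(i, j) \<noteq> (p, Suc p)" using asc by auto
      from simple_transp_less[OF 2(1) this] 2 show ?thesis unfolding inversion_pairs_def
        by (intro CollectI exI[of _ "?s i"] exI[of _ "?s j"]) auto
    qed
  qed
qed

lemma inversion_pairs_descent:
  assumes u: "inj u" and desc: "u (Suc p) < u p"
  shows "inversion_pairs u = insert {u p, u (Suc p)} (inversion_pairs (u \<circ> simple_transp p))"
    and "{u p, u (Suc p)} \<notin> inversion_pairs (u \<circ> simple_transp p)"
proof -
  let ?v = "u \<circ> simple_transp p"
  have "inj ?v" using u by (simp add: inj_compose simple_transp_def)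
  moreover have "?v p < ?v (Suc p)" using desc by (simp add: simple_transp_apply)
  moreover have "?v \<circ> simple_transp p = u" by (simp add: fun_eq_iff)
  moreover have "{?v p, ?v (Suc p)} = {u p, u (Suc p)}" by (auto simp: simple_transp_apply)
  ultimately show "inversion_pairs u = insert {u p, u (Suc p)} (inversion_pairs ?v)"
    and "{u p, u (Suc p)} \<notin> inversion_pairs ?v"
    using inversion_pairs_ascent[of ?v p] by metis+
qed

text \<open>The \<open>k\<close>-th entry is the pair of strands that cross at the \<open>k\<close>-th letter, named by their values.\<close>

definition crossing_pairs :: "nat list \<Rightarrow> nat set list" where
  "crossing_pairs a = map (\<lambda>k. word_perm (take k a) ` {a ! k, Suc (a ! k)}) [0..<length a]"

lemma crossing_pairs_Nil [simp]: "crossing_pairs [] = []"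
  by (simp add: crossing_pairs_def)

lemma nth_crossing_pairs_append:
  "crossing_pairs (a @ p # b) ! length a = word_perm a ` {p, Suc p}"
  by (simp add: crossing_pairs_def del: upt_Suc)

lemma length_crossing_pairs [simp]: "length (crossing_pairs a) = length a"
  by (simp add: crossing_pairs_def)

lemma crossing_pairs_snoc [simp]:
  "crossing_pairs (a @ [p]) = crossing_pairs a @ [{word_perm a p, word_perm a (Suc p)}]"
  by (simp add: crossing_pairs_def nth_append)

lemma word_perm_inj: "inj (word_perm a)"
  using bij_word_perm bij_is_inj by blast

text \<open>Induction on the last letter. At an ascent both sides gain the same pair. At a descent
  the pair is already an inversion, hence already listed, so the list stops being distinct while the
  inversions shrink.\<close>

lemma inversion_pairs_word:
  "inversion_pairs (word_perm a) \<subseteq> set (crossing_pairs a)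
   \<and> (distinct (crossing_pairs a) \<longrightarrow> inversion_pairs (word_perm a) = set (crossing_pairs a))"
proof (induction a rule: rev_induct)
  case (snoc p a)
  let ?u = "word_perm a"
  have eq: "word_perm (a @ [p]) = ?u \<circ> simple_transp p" by simp
  have "?u p \<noteq> ?u (Suc p)" using word_perm_inj[of a] by (simp add: inj_eq)
  then consider "?u p < ?u (Suc p)" | "?u (Suc p) < ?u p" by linarith
  then show ?case
  proof cases
    case 1
    show ?thesis unfolding eq inversion_pairs_ascent(1)[OF word_perm_inj 1] using snoc by auto
  next
    case 2
    note d = inversion_pairs_descent[OF word_perm_inj 2]
    have "\<not> distinct (crossing_pairs (a @ [p]))" using d(1) snoc by auto
    moreover have "inversion_pairs (?u \<circ> simple_transp p) \<subseteq> inversion_pairs ?u" using d(1) by blast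
    ultimately show ?thesis unfolding eq using snoc by (metis (no_types, lifting)
          crossing_pairs_snoc set_append Un_upper1 order_trans)
  qed
qed simp

lemma finite_inversion_pairs_word [simp]: "finite (inversion_pairs (word_perm a))"
  using inversion_pairs_word finite_subset by blast

lemma card_inversion_pairs_word_le: "card (inversion_pairs (word_perm a)) \<le> length a"
proof -
  have "card (inversion_pairs (word_perm a)) \<le> card (set (crossing_pairs a))"
    using inversion_pairs_word by (intro card_mono) auto
  also have "\<dots> \<le> length a" using card_length[of "crossing_pairs a"] by simp
  finally show ?thesis .
qed

lemma card_inversion_pairs_word_eq_iff:
  "card (inversion_pairs (word_perm a)) = length a \<longleftrightarrow> distinct (crossing_pairs a)"
proof
  assume "distinct (crossing_pairs a)"
  then show "card (inversion_pairs (word_perm a)) = length a"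
    using inversion_pairs_word distinct_card[of "crossing_pairs a"] by simp
next
  assume "card (inversion_pairs (word_perm a)) = length a"
  moreover have "card (inversion_pairs (word_perm a)) \<le> card (set (crossing_pairs a))"
    using inversion_pairs_word by (intro card_mono) auto
  ultimately have "card (set (crossing_pairs a)) = length (crossing_pairs a)"
    using card_length[of "crossing_pairs a"] by simp
  then show "distinct (crossing_pairs a)" by (rule card_distinct)
qed

section \<open>Coxeter length as the number of inversions\<close>

lemma no_descent_imp_id:
  assumes w: "w permutes {1..n}" and asc: "\<And>p. p \<in> {1..n - 1} \<Longrightarrow> \<not> w (Suc p) < w p"
  shows "w = id"
proof -
  \<comment> \<open>Without descents \<open>w\<close> increases on \<open>{1..n}\<close>, so it
    cannot fall below the identity; a permutation with this property is the identity.\<close>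
  have "i \<le> w i" if "i \<in> {1..n}" for i
    using that
  proof (induction i)
    case (Suc i)
    show ?case
    proof (cases "i = 0")
      case True
      then show ?thesis using permutes_in_image[OF w, of "Suc i"] Suc.prems by simp
    next
      case False
      have "w i \<noteq> w (Suc i)" using permutes_inj[OF w] by (simp add: inj_eq)
      with False Suc asc[of i] show ?thesis by fastforce
    qed
  qed simp
  then show ?thesis using permutes_natset_ge[OF w] by blast
qed

text \<open>Bubble sort: removing a descent on the right lowers the inversion count by one, and the
  removed letters spell the word. Finiteness is carried along because \<open>card\<close> of an
  infinite set is \<open>0\<close>.\<close>

lemma reduced_word_exists:
  assumes "w permutes {1..n}"
  shows "\<exists>a. set a \<subseteq> {1..n - 1} \<and> length a = card (inversion_pairs w) \<and> w = word_perm a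
    \<and> finite (inversion_pairs w)"
proof -
  have "inversion_pairs w \<subseteq> Pow {1..n}"
  proof
    fix X assume "X \<in> inversion_pairs w"
    then obtain i j where ij: "i < j" "w j < w i" "X = {w i, w j}"
      by (auto simp: inversion_pairs_def)
    have fixed: "w k = k" if "k \<notin> {1..n}" for k using that assms by (simp add: permutes_not_in)
    have "i \<in> {1..n}"
      by (rule ccontr) (use ij(1,2) fixed[of i] fixed[of j] in auto)
    then have "w i \<in> {1..n}" using permutes_in_image[OF assms] by blast
    \<comment> \<open>\<open>w j\<close> is below \<open>w i\<close>, hence at most
      \<open>n\<close>; it is not \<open>0\<close> because \<open>w\<close> already maps
      \<open>0\<close> to \<open>0\<close>.\<close>
    moreover have "j \<noteq> 0" using ij(1) by simp
    then have "w j \<noteq> 0" using fixed[of 0] permutes_inj[OF assms] by (metis atLeastAtMost_iff injD not_one_le_zero)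
    ultimately show "X \<in> Pow {1..n}" using ij(2,3) by auto
  qed
  then have "finite (inversion_pairs w)" by (rule finite_subset) simp
  with assms show ?thesis
  proof (induction "card (inversion_pairs w)" arbitrary: w rule: less_induct)
    case less
    show ?case
    proof (cases "\<exists>p\<in>{1..n - 1}. w (Suc p) < w p")
      case False
      then have "w = id" using no_descent_imp_id[OF less.prems(1)] by blast
      then show ?thesis by (intro exI[of _ "[]"]) simp
    next
      case True
      then obtain p where p: "p \<in> {1..n - 1}" "w (Suc p) < w p" by blast
      let ?v = "w \<circ> simple_transp p"
      note d = inversion_pairs_descent[OF permutes_inj[OF less.prems(1)] p(2)]
      have fin: "finite (inversion_pairs ?v)" using less.prems(2) d(1) by simp
      have card: "card (inversion_pairs w) = Suc (card (inversion_pairs ?v))"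
        using d fin by simp
      have "?v permutes {1..n}"
        using less.prems(1) simple_transp_permutes[OF p(1)] by (rule permutes_compose[rotated])
      from less.hyps[OF _ this fin] card obtain a where a: "set a \<subseteq> {1..n - 1}"
        "length a = card (inversion_pairs ?v)" "?v = word_perm a" by auto
      have "w = word_perm (a @ [p])" unfolding word_perm_append a(3)[symmetric] by (simp add: fun_eq_iff)
      with a p card less.prems(2) show ?thesis by (intro exI[of _ "a @ [p]"]) auto
    qed
  qed
qed

lemma coxeter_length_eq_card:
  assumes "w permutes {1..n}"
  shows "coxeter_length n w = card (inversion_pairs w)"
  unfolding coxeter_length_def
proof (rule Least_equality)
  show "\<exists>a. set a \<subseteq> {1..n - 1} \<and> length a = card (inversion_pairs w) \<and> w = word_perm a"
    using reduced_word_exists[OF assms] by blast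
qed (use card_inversion_pairs_word_le in blast)

lemma coxeter_length_word_le: "set a \<subseteq> {1..n - 1} \<Longrightarrow> coxeter_length n (word_perm a) \<le> length a"
  using coxeter_length_eq_card[OF word_perm_permutes] card_inversion_pairs_word_le by metis

text \<open>Minimising over words amounts to minimising over permutations first: each permutation
  has a word as long as its Coxeter length, and no word for it is shorter.\<close>

lemma fpf_involution_word_iff:
  "fpf_involution_word n z a \<longleftrightarrow>
    set a \<subseteq> {1..n - 1} \<and> fpf_atom n z (word_perm a) \<and> coxeter_length n (word_perm a) = length a"
proof
  assume f: "fpf_involution_word n z a"
  then have a: "set a \<subseteq> {1..n - 1}" "z = word_perm (rev a) \<circ> one_fpf n \<circ> word_perm a"
    and min: "\<And>b. set b \<subseteq> {1..n - 1} \<Longrightarrow> z = word_perm (rev b) \<circ> one_fpf n \<circ> word_perm b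
      \<Longrightarrow> length a \<le> length b"
    by (auto simp: fpf_involution_word_def is_arg_min_def not_less)
  have *: "length a \<le> coxeter_length n v"
    if v: "v permutes {1..n}" "z = inv v \<circ> one_fpf n \<circ> v" for v
  proof -
    from reduced_word_exists[OF v(1)] obtain b where
      b: "set b \<subseteq> {1..n - 1}" "length b = card (inversion_pairs v)" "v = word_perm b" by blast
    then have "length a \<le> length b" using v(2) inv_word_perm by (intro min) auto
    then show ?thesis using b v(1) by (simp add: coxeter_length_eq_card)
  qed
  have "word_perm a permutes {1..n}" by (rule word_perm_permutes[OF a(1)])
  moreover have "z = inv (word_perm a) \<circ> one_fpf n \<circ> word_perm a" using a(2) by (simp add: inv_word_perm)
  moreover have "coxeter_length n (word_perm a) \<le> length a" by (rule coxeter_length_word_le[OF a(1)])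
  ultimately show "set a \<subseteq> {1..n - 1} \<and> fpf_atom n z (word_perm a)
      \<and> coxeter_length n (word_perm a) = length a"
    using * a(1) unfolding fpf_atom_def is_arg_min_def
    by (metis le_antisym le_trans not_less)
next
  assume f: "set a \<subseteq> {1..n - 1} \<and> fpf_atom n z (word_perm a)
    \<and> coxeter_length n (word_perm a) = length a"
  have "length a \<le> length b"
    if b: "set b \<subseteq> {1..n - 1}" "z = word_perm (rev b) \<circ> one_fpf n \<circ> word_perm b" for b
  proof -
    have "coxeter_length n (word_perm a) \<le> coxeter_length n (word_perm b)"
      using f b word_perm_permutes[OF b(1)]
      by (auto simp: fpf_atom_def is_arg_min_def not_less inv_word_perm)
    then show ?thesis using f coxeter_length_word_le[OF b(1)] by linarith
  qed
  then show "fpf_involution_word n z a"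
    using f by (auto simp: fpf_involution_word_def is_arg_min_def fpf_atom_def inv_word_perm not_less)
qed

text \<open>Reversing a reduced word for \<open>v\<close> spells \<open>inv v\<close>, which gives
  one inequality; using it for \<open>w\<close> and for \<open>inv w\<close> gives both.\<close>

lemma card_inversion_pairs_inv:
  assumes "w permutes {1..n}"
  shows "card (inversion_pairs (inv w)) = card (inversion_pairs w)"
proof -
  have le: "card (inversion_pairs (inv v)) \<le> card (inversion_pairs v)" if "v permutes {1..n}" for v
    using reduced_word_exists[OF that] card_inversion_pairs_word_le inv_word_perm length_rev by metis
  show ?thesis using le[OF assms] le[OF permutes_inv[OF assms]] permutes_inv_inv[OF assms] by simp
qed

section \<open>Linear extensions of the NE order\<close>

definition cell_letters :: "(nat \<times> nat) list \<Rightarrow> nat list" where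
  "cell_letters cs = map (\<lambda>(p, q). p + q - 1) cs"

text \<open>A linear extension of \<open>le_NE\<close> on \<open>D\<close> alone, as a list instead
  of a numbering of the square. Since \<open>le_NE\<close> is reflexive, the condition also excludes
  repeated cells.\<close>

definition reads :: "(nat \<times> nat) set \<Rightarrow> (nat \<times> nat) list \<Rightarrow> bool" where
  "reads D cs \<longleftrightarrow> set cs = D \<and> sorted_wrt (\<lambda>s t. \<not> le_NE t s) cs"

lemma cell_letters_simps [simp]:
  "cell_letters [] = []"
  "cell_letters (c # cs) = (fst c + snd c - 1) # cell_letters cs"
  "cell_letters (cs @ ds) = cell_letters cs @ cell_letters ds"
  "length (cell_letters cs) = length cs"
  "cell_letters (rev cs) = rev (cell_letters cs)"
  by (auto simp: cell_letters_def rev_map split: prod.split)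

lemma set_cell_letters: "set (cell_letters cs) = (\<lambda>(p, q). p + q - 1) ` set cs"
  by (simp add: cell_letters_def)

lemma reads_distinct: "reads D cs \<Longrightarrow> distinct cs"
proof -
  have "sorted_wrt (\<lambda>s t. \<not> le_NE t s) cs \<Longrightarrow> distinct cs"
    by (induction cs) (auto simp: le_NE_def)
  then show "reads D cs \<Longrightarrow> distinct cs" by (simp add: reads_def)
qed

lemma length_reads: "reads D cs \<Longrightarrow> length cs = card D"
  using reads_distinct distinct_card by (fastforce simp: reads_def)

lemma simple_transp_comm:
  assumes "Suc p < q \<or> Suc q < p"
  shows "simple_transp p \<circ> simple_transp q = simple_transp q \<circ> simple_transp p"
  using assms by (auto simp: fun_eq_iff simple_transp_apply)

lemma simple_transp_word_comm:
  assumes "\<forall>q\<in>set a. Suc p < q \<or> Suc q < p"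
  shows "word_perm a \<circ> simple_transp p = simple_transp p \<circ> word_perm a"
  using assms
proof (induction a)
  case (Cons q a)
  then have "simple_transp p \<circ> simple_transp q = simple_transp q \<circ> simple_transp p"
    by (intro simple_transp_comm) auto
  with Cons show ?case by (auto simp: fun_eq_iff)
qed simp

text \<open>
  A cell that may come first can be moved to the front of any other linear extension, since the
  cells it passes are incomparable to it and hence lie on antidiagonals at distance at least two.
\<close>

lemma reads_word_perm_unique:
  assumes "reads D cs" "reads D ds" "\<forall>(p, q)\<in>D. 1 \<le> p \<and> 1 \<le> q"
  shows "word_perm (cell_letters cs) = word_perm (cell_letters ds)"
  using assms
proof (induction cs arbitrary: D ds)
  case Nil
  then show ?case by (simp add: reads_def)
next
  case (Cons c cs)
  obtain i j where c: "c = (i, j)" by fastforce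
  from Cons.prems have "c \<in> set ds" by (auto simp: reads_def)
  then obtain xs ys where ds: "ds = xs @ c # ys" by (meson split_list)
  have dist: "distinct ds" "distinct (c # cs)" using Cons.prems reads_distinct by blast+
  have sets: "set cs = D - {c}" "set (xs @ ys) = D - {c}"
    using Cons.prems dist ds by (auto simp: reads_def)
  have "reads (D - {c}) cs" "reads (D - {c}) (xs @ ys)"
    using Cons.prems(1,2) sets ds by (auto simp: reads_def sorted_wrt_append)
  then have IH: "word_perm (cell_letters cs) = word_perm (cell_letters (xs @ ys))"
    using Cons.prems(3) by (intro Cons.IH[of "D - {c}"]) auto
  have far: "Suc (i + j - 1) < q \<or> Suc q < i + j - 1" if q: "q \<in> set (cell_letters xs)" for q
  proof -
    from q obtain k l where kl: "(k, l) \<in> set xs" "q = k + l - 1"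
      by (auto simp: set_cell_letters)
    then have "\<not> le_NE (i, j) (k, l)" using Cons.prems(2) ds c by (auto simp: reads_def sorted_wrt_append)
    moreover have "(k, l) \<in> set cs" using kl sets by auto
    then have "\<not> le_NE (k, l) (i, j)" using Cons.prems(1) c by (auto simp: reads_def)
    moreover have "(i, j) \<in> D" "(k, l) \<in> D" using \<open>(k, l) \<in> set cs\<close> Cons.prems(1) c by (auto simp: reads_def)
    then have "1 \<le> i" "1 \<le> j" "1 \<le> k" "1 \<le> l" using Cons.prems(3) by auto
    ultimately show ?thesis using kl(2) by (auto simp: le_NE_def)
  qed
  have "word_perm (cell_letters ds)
      = word_perm (cell_letters xs) \<circ> simple_transp (i + j - 1) \<circ> word_perm (cell_letters ys)"
    by (simp add: ds c o_assoc)
  also have "\<dots> = simple_transp (i + j - 1) \<circ> word_perm (cell_letters (xs @ ys))"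
    using simple_transp_word_comm[of "cell_letters xs" "i + j - 1"] far by (simp add: o_assoc)
  finally show ?case using IH c by simp
qed

section \<open>Reading words as linear extensions\<close>

lemma reading_word_imp_reads:
  assumes "reading_word n D a" "D \<subseteq> {1..n} \<times> {1..n}"
  shows "\<exists>cs. reads D cs \<and> a = cell_letters cs"
proof -
  from assms(1) obtain \<omega> where w: "reading_order n \<omega>" "a = reading_word_of n \<omega> D"
    by (auto simp: reading_word_def)
  let ?S = "{1..n} \<times> {1..n}" and ?ks = "sorted_list_of_set (\<omega> ` D)"
  have inj: "inj_on \<omega> ?S" using w(1) by (auto simp: reading_order_def bij_betw_def)
  have fin: "finite D" using assms(2) finite_subset by blast
  define cs where "cs = map (inv_into ?S \<omega>) ?ks"
  have inv: "inv_into ?S \<omega> (\<omega> c) = c" if "c \<in> D" for c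
    using inj that assms(2) by (meson inv_into_f_f subsetD)
  have "set cs = D" using inv fin by (force simp: cs_def)
  moreover have "sorted_wrt (\<lambda>s t. \<not> le_NE t s) cs"
    unfolding cs_def sorted_wrt_map
  proof (rule sorted_wrt_mono_rel[OF _ strict_sorted_list_of_set])
    fix k l assume kl: "k \<in> set ?ks" "l \<in> set ?ks" "k < l"
    then obtain c d where cd: "c \<in> D" "d \<in> D" "k = \<omega> c" "l = \<omega> d" using fin by auto
    have "\<not> le_NE d c"
    proof
      assume "le_NE d c"
      moreover have "d \<noteq> c" "c \<in> ?S" "d \<in> ?S" using cd kl assms(2) by auto
      ultimately have "\<omega> d < \<omega> c" using w(1) unfolding reading_order_def by blast
      then show False using cd kl by simp
    qed
    then show "\<not> le_NE (inv_into ?S \<omega> l) (inv_into ?S \<omega> k)" using cd inv by simp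
  qed
  moreover have "a = cell_letters cs"
    using w(2) by (simp add: reading_word_of_def cell_letters_def cs_def comp_def)
  ultimately show ?thesis by (auto simp: reads_def)
qed

text \<open>Without a reading word, condition (b) would hold vacuously while (a) fails.\<close>

lemma reading_word_exists: "\<exists>a. reading_word n D a"
proof -
  \<comment> \<open>Rows from top to bottom, each from right to left. The offset
    \<open>n + 1 - j\<close> runs through \<open>1\<close> to \<open>n\<close>, so row
    \<open>i\<close> receives the block of numbers after \<open>(i - 1) * n\<close>.\<close>
  define \<omega> :: "nat \<times> nat \<Rightarrow> nat" where "\<omega> = (\<lambda>(i, j). (i - 1) * n + (n + 1 - j))"
  let ?S = "{1..n} \<times> {1..n}"
  have less: "\<omega> s < \<omega> t" if st: "s \<in> ?S" "t \<in> ?S" and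
    c: "fst s < fst t \<or> fst s = fst t \<and> snd t < snd s" for s t
  proof -
    obtain i j k l where eq: "s = (i, j)" "t = (k, l)" by fastforce
    show ?thesis
    proof (cases "i < k")
      case True
      then obtain d where "k = Suc (i + d)" using less_imp_Suc_add by blast
      moreover obtain e where "i = Suc e" using st eq by (cases i) auto
      moreover have "n + 1 - j < n + (n + 1 - l)" using st eq by auto
      ultimately show ?thesis using eq by (auto simp: \<omega>_def algebra_simps)
    next
      case False
      then show ?thesis using st eq c by (auto simp: \<omega>_def)
    qed
  qed
  have inj: "inj_on \<omega> ?S"
  proof (rule inj_onI)
    fix s t assume "s \<in> ?S" "t \<in> ?S" "\<omega> s = \<omega> t"
    then show "s = t" using less[of s t] less[of t s] by (metis less_irrefl nat_neq_iff prod_eqI)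
  qed
  have "\<omega> ` ?S \<subseteq> {1..n\<^sup>2}"
  proof
    fix k assume "k \<in> \<omega> ` ?S"
    then obtain i j where ij: "i \<in> {1..n}" "j \<in> {1..n}" "k = (i - 1) * n + (n + 1 - j)"
      by (auto simp: \<omega>_def)
    then have "(i - 1) * n \<le> (n - 1) * n" by (intro mult_right_mono) auto
    moreover have "n + 1 - j \<le> n" using ij(2) by (cases j) auto
    ultimately have "k \<le> (n - 1) * n + n" unfolding ij(3) by (rule add_mono)
    also have "\<dots> = n\<^sup>2" using ij by (cases n) (auto simp: power2_eq_square)
    finally show "k \<in> {1..n\<^sup>2}" using ij by auto
  qed
  moreover have "card (\<omega> ` ?S) = card {1..n\<^sup>2}" using card_image[OF inj] by (simp add: power2_eq_square)
  ultimately have "\<omega> ` ?S = {1..n\<^sup>2}" by (intro card_subset_eq) auto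
  then have "bij_betw \<omega> ?S {1..n\<^sup>2}" using inj by (simp add: bij_betw_def)
  moreover have "\<omega> s < \<omega> t" if "s \<in> ?S" "t \<in> ?S" "le_NE s t" "s \<noteq> t" for s t
    using that by (intro less) (auto simp: le_NE_def)
  ultimately show ?thesis unfolding reading_word_def reading_order_def by blast
qed

section \<open>Pipes as strands of a reading word\<close>

definition triangle :: "nat \<Rightarrow> (nat \<times> nat) set" where
  "triangle n = {(i, j) \<in> {1..n} \<times> {1..n}. i + j \<le> n}"

lemma triangle_subset_square: "triangle n \<subseteq> {1..n} \<times> {1..n}"
  by (auto simp: triangle_def)

definition row_cells :: "nat \<Rightarrow> (nat \<times> nat) set \<Rightarrow> nat \<Rightarrow> nat \<Rightarrow> (nat \<times> nat) list" where
  "row_cells n D i j = map (Pair i) (filter (\<lambda>b. (i, b) \<in> D) (rev [j..<Suc n]))"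

definition cells_above :: "nat \<Rightarrow> (nat \<times> nat) set \<Rightarrow> nat \<Rightarrow> (nat \<times> nat) list" where
  "cells_above n D i = concat (map (\<lambda>k. row_cells n D k 1) [1..<i])"

lemma cells_above_Suc:
  "1 \<le> i \<Longrightarrow> cells_above n D (Suc i) = cells_above n D i @ row_cells n D i 1"
  by (simp add: cells_above_def)

lemma row_cells_Suc:
  "j \<le> n \<Longrightarrow> row_cells n D i j = row_cells n D i (Suc j) @ (if (i, j) \<in> D then [(i, j)] else [])"
  by (simp add: row_cells_def upt_conv_Cons del: upt_Suc)

lemma row_cells_split:
  assumes "1 \<le> j" "j \<le> Suc n"
  shows "row_cells n D i 1 = row_cells n D i j @ map (Pair i) (filter (\<lambda>b. (i, b) \<in> D) (rev [1..<j]))"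
proof -
  have "[1..<Suc n] = [1..<j] @ [j..<Suc n]"
    using assms upt_add_eq_append[of 1 j "Suc n - j"] by simp
  then show ?thesis by (simp add: row_cells_def del: upt_Suc)
qed

lemma set_cells_above:
  "set (cells_above n D i) = {(k, l) \<in> D. 1 \<le> k \<and> k < i \<and> 1 \<le> l \<and> l \<le> n}"
  by (auto simp: cells_above_def row_cells_def image_iff less_Suc_eq_le simp del: upt_Suc)

lemma sorted_row_cells: "sorted_wrt (\<lambda>s t. \<not> le_NE t s) (row_cells n D i j)"
proof -
  have "sorted_wrt (\<lambda>a b. b < a) (rev [j..<Suc n])"
    by (simp add: sorted_wrt_rev del: upt_Suc)
  then have "sorted_wrt (\<lambda>a b. b < a) (filter (\<lambda>b. (i, b) \<in> D) (rev [j..<Suc n]))"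
    by (rule sorted_wrt_filter)
  then show ?thesis unfolding row_cells_def sorted_wrt_map
    by (rule sorted_wrt_mono_rel[rotated]) (auto simp: le_NE_def)
qed

lemma reads_cells_above:
  assumes "D \<subseteq> {1..n} \<times> {1..n}"
  shows "reads D (cells_above n D (Suc n))"
proof -
  have "1 \<le> i \<Longrightarrow> sorted_wrt (\<lambda>s t. \<not> le_NE t s) (cells_above n D i)" for i
  proof (induction i rule: dec_induct)
    case (step i)
    then show ?case
      by (auto simp: cells_above_Suc sorted_wrt_append sorted_row_cells set_cells_above)
        (auto simp: row_cells_def le_NE_def)
  qed (simp add: cells_above_def)
  moreover have "set (cells_above n D (Suc n)) = D" using assms by (auto simp: set_cells_above)
  ultimately show ?thesis by (simp add: reads_def)
qed

text \<open>
  The top endpoint of the pipe through an edge. It is computed from the cells that precede the edge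
  in the row order, in which rows are read from top to bottom, each from right to left. An edge in
  row \<open>i\<close> and column \<open>j\<close> is at position \<open>i + j - 1\<close> among the edges cut at that moment.
\<close>

fun edge_label :: "nat \<Rightarrow> (nat \<times> nat) set \<Rightarrow> edge \<Rightarrow> nat" where
  "edge_label n D (Left_Edge i j) =
     word_perm (cell_letters (cells_above n D i @ row_cells n D i j)) (i + j - 1)"
| "edge_label n D (Top_Edge i j) = word_perm (cell_letters (cells_above n D i)) (i + j - 1)"

fun valid_edge :: "nat \<Rightarrow> edge \<Rightarrow> bool" where
  "valid_edge n (Left_Edge i j) \<longleftrightarrow> 1 \<le> i \<and> 1 \<le> j \<and> i + j \<le> Suc n"
| "valid_edge n (Top_Edge i j) \<longleftrightarrow> 1 \<le> i \<and> 1 \<le> j \<and> i + j \<le> Suc n"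

text \<open>The letters of these cells are \<open>i + b - 1\<close> with \<open>b\<close> at least
  \<open>j\<close>, hence all greater than \<open>x\<close>.\<close>

lemma row_cells_fixes:
  "x < i + j - 1 \<Longrightarrow> word_perm (cell_letters (row_cells n D i j)) x = x"
  by (rule word_perm_fixes) (auto simp: set_cell_letters row_cells_def)

text \<open>The label of the bottom edge is read off after the whole row \<open>i\<close>, but the
  cells left of column \<open>j\<close> have letters at most \<open>i + j - 2\<close>, which do not
  move \<open>i + j\<close>.\<close>

lemma edge_label_bottom:
  assumes "1 \<le> i" "1 \<le> j" "j \<le> n"
  shows "edge_label n D (Top_Edge (Suc i) j)
    = word_perm (cell_letters (cells_above n D i @ row_cells n D i j)) (i + j)"
proof -
  let ?r = "map (Pair i) (filter (\<lambda>b. (i, b) \<in> D) (rev [1..<j]))"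
  have "word_perm (cell_letters ?r) (i + j) = i + j"
    by (rule word_perm_fixes) (auto simp: set_cell_letters)
  then show ?thesis using assms row_cells_split[of j n D i] by (simp add: cells_above_Suc)
qed

text \<open>One cell as one step of the word: \<open>u\<close> is the product over the cells read
  before \<open>(i, j)\<close>. The top and right edges carry the strands at positions
  \<open>i + j - 1\<close> and \<open>i + j\<close>; the letter \<open>i + j - 1\<close>, present
  exactly for a crossing, exchanges the two on the left and bottom edges.\<close>

lemma edge_label_out:
  fixes D :: "(nat \<times> nat) set"
  assumes "1 \<le> i" "1 \<le> j" "i + j \<le> Suc n"
  defines "u \<equiv> word_perm (cell_letters (cells_above n D i @ row_cells n D i (Suc j)))"
  shows "edge_label n D (Top_Edge i j) = u (i + j - 1)"
    and "edge_label n D (Left_Edge i (Suc j)) = u (i + j)"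
    and "edge_label n D (Left_Edge i j) = (if (i, j) \<in> D then u (i + j) else u (i + j - 1))"
    and "i + j \<le> n \<Longrightarrow> edge_label n D (Top_Edge (Suc i) j)
      = (if (i, j) \<in> D then u (i + j - 1) else u (i + j))"
proof -
  have j: "j \<le> n" using assms by simp
  have "Suc (i + j - 1) = i + j" using assms by simp
  then show "edge_label n D (Left_Edge i j) = (if (i, j) \<in> D then u (i + j) else u (i + j - 1))"
    and "i + j \<le> n \<Longrightarrow> edge_label n D (Top_Edge (Suc i) j)
      = (if (i, j) \<in> D then u (i + j - 1) else u (i + j))"
    using edge_label_bottom[OF assms(1,2) j, of D] assms(1)
    by (auto simp: row_cells_Suc[OF j] u_def simple_transp_apply)
  show "edge_label n D (Top_Edge i j) = u (i + j - 1)"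
    using assms(1,2) by (simp add: u_def row_cells_fixes)
qed (simp add: u_def)

text \<open>Each kind of segment joins two edges with equal values in \<open>edge_label_out\<close>;
  on the antidiagonal \<open>D\<close> has no cells, so the values of a bump apply.\<close>

lemma wire_edge_label:
  assumes "wire n D e f" "D \<subseteq> triangle n"
  shows "edge_label n D e = edge_label n D f"
  using assms(1)
proof cases
  case (diagonal_turn i j)
  then have "(i, j) \<notin> D" using assms(2) by (auto simp: triangle_def)
  then show ?thesis using diagonal_turn edge_label_out(1,3)[of i j n D] by (simp del: edge_label.simps)
next
  case (cross_horizontal i j)
  then show ?thesis using edge_label_out(2,3)[of i j n D] by (simp del: edge_label.simps)
next
  case (cross_vertical i j)
  then show ?thesis using edge_label_out(1,4)[of i j n D] by (simp del: edge_label.simps)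
next
  case (bump_left_top i j)
  then show ?thesis using edge_label_out(1,3)[of i j n D] by (simp del: edge_label.simps)
next
  case (bump_bottom_right i j)
  then show ?thesis using edge_label_out(2,4)[of i j n D] by (simp del: edge_label.simps)
qed

lemma wires_edge_label:
  "(wire n D)\<^sup>*\<^sup>* e f \<Longrightarrow> D \<subseteq> triangle n \<Longrightarrow> edge_label n D e = edge_label n D f"
  by (induction rule: rtranclp_induct) (auto dest: wire_edge_label)

lemma edge_label_top: "edge_label n D (Top_Edge (Suc 0) j) = j"
  by (simp add: cells_above_def)

text \<open>Below row \<open>i\<close> all letters exceed \<open>i\<close>, so the value at
  \<open>i\<close> is final once row \<open>i\<close> has been read.\<close>

lemma edge_label_left:
  assumes "1 \<le> i" "i \<le> n"
  shows "edge_label n D (Left_Edge i 1) = word_perm (cell_letters (cells_above n D (Suc n))) i"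
proof -
  have "i \<le> k \<Longrightarrow> word_perm (cell_letters (cells_above n D (Suc k))) i
      = word_perm (cell_letters (cells_above n D (Suc i))) i" for k
  proof (induction k rule: dec_induct)
    case (step k)
    then show ?case using assms by (simp add: cells_above_Suc[of "Suc k"] row_cells_fixes)
  qed simp
  from this[OF assms(2)] show ?thesis by (simp add: cells_above_Suc[OF assms(1)])
qed

text \<open>The pipe is traced backwards, to the left or downwards, until column \<open>1\<close>.
  The measure falls when \<open>j\<close> drops or \<open>i\<close> grows, and the extra
  \<open>Suc\<close> covers the step from a top edge to the left edge of the same cell.\<close>

lemma pipe_from_left:
  assumes "valid_edge n e"
  shows "\<exists>p\<in>{1..n}. e \<in> pipe n D p"
  using assms
proof (induction "case e of Left_Edge i j \<Rightarrow> 2 * j + 2 * (n - i) | Top_Edge i j \<Rightarrow> Suc (2 * j + 2 * (n - i))"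
    arbitrary: e rule: less_induct)
  case less
  have step: ?case if "wire n D f e" "valid_edge n f"
    "(case f of Left_Edge i j \<Rightarrow> 2 * j + 2 * (n - i) | Top_Edge i j \<Rightarrow> Suc (2 * j + 2 * (n - i)))
     < (case e of Left_Edge i j \<Rightarrow> 2 * j + 2 * (n - i) | Top_Edge i j \<Rightarrow> Suc (2 * j + 2 * (n - i)))" for f
    using less.hyps[OF that(3,2)] that(1) by (auto simp: pipe_def intro: rtranclp.rtrancl_into_rtrancl)
  show ?case
  proof (cases e)
    case (Left_Edge i j)
    show ?thesis
    proof (cases "j = 1")
      case True
      then show ?thesis using less.prems Left_Edge by (auto simp: pipe_def)
    next
      case False
      then obtain k where k: "j = k + 1" "1 \<le> k" using less.prems Left_Edge by (cases j) auto
      show ?thesis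
      proof (cases "(i, k) \<in> D")
        case True
        show ?thesis
          by (rule step[of "Left_Edge i k"])
            (use True less.prems Left_Edge k in \<open>auto intro: wire.cross_horizontal[simplified]\<close>)
      next
        case False
        show ?thesis
          by (rule step[of "Top_Edge (i + 1) k"])
            (use False less.prems Left_Edge k in \<open>auto intro: wire.bump_bottom_right[simplified]\<close>)
      qed
    qed
  next
    case (Top_Edge i j)
    show ?thesis
    proof (cases "(i, j) \<in> D \<and> i + j \<le> n")
      case True
      show ?thesis
        by (rule step[of "Top_Edge (i + 1) j"])
          (use True less.prems Top_Edge in \<open>auto intro: wire.cross_vertical[simplified]\<close>)
    next
      case False
      then have "wire n D (Left_Edge i j) (Top_Edge i j)"
        using less.prems Top_Edge by (cases "i + j = n + 1") (auto intro: wire.intros)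
      then show ?thesis
        by (intro step[of "Left_Edge i j"]) (use less.prems Top_Edge in auto)
    qed
  qed
qed

section \<open>Crossings of pipes as crossings of strands\<close>

context
  fixes n :: nat and D :: "(nat \<times> nat) set" and cs :: "(nat \<times> nat) list" and w :: "nat \<Rightarrow> nat"
  assumes D: "D \<subseteq> triangle n"
  defines "cs \<equiv> cells_above n D (Suc n)"
    and "w \<equiv> word_perm (cell_letters cs)"
begin

lemma reads_row_order: "reads D cs"
  unfolding cs_def using D triangle_subset_square by (intro reads_cells_above) blast

text \<open>All valid edges lie on some pipe, and along pipe \<open>p\<close> the label is
  constantly \<open>w p\<close>. As \<open>w\<close> is injective, the label identifies the
  pipe.\<close>

lemma edge_in_pipe_iff:
  assumes "valid_edge n e" "p \<in> {1..n}"
  shows "e \<in> pipe n D p \<longleftrightarrow> edge_label n D e = w p"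
proof -
  have label: "edge_label n D f = w q" if "q \<in> {1..n}" "f \<in> pipe n D q" for f q
    using that D wires_edge_label[of n D "Left_Edge q 1" f] edge_label_left[of q n D]
    by (auto simp: pipe_def w_def cs_def)
  from pipe_from_left[OF assms(1)] obtain q where q: "q \<in> {1..n}" "e \<in> pipe n D q" by blast
  have "inj w" by (simp add: w_def word_perm_inj)
  then show ?thesis using label[OF q] label[OF assms(2)] q(2) by (auto simp: inj_eq)
qed

lemma row_order_perm_permutes: "w permutes {1..n}"
  unfolding w_def using D reads_row_order
  by (intro word_perm_permutes) (fastforce simp: set_cell_letters triangle_def reads_def)

lemma pipe_top_iff:
  assumes "v permutes {1..n}"
  shows "(\<forall>i\<in>{1..n}. Top_Edge 1 (v i) \<in> pipe n D i) \<longleftrightarrow> v = w"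
proof -
  have "Top_Edge 1 (v i) \<in> pipe n D i \<longleftrightarrow> v i = w i" if i: "i \<in> {1..n}" for i
  proof -
    have "valid_edge n (Top_Edge 1 (v i))"
      using permutes_in_image[OF assms] i by auto
    from edge_in_pipe_iff[OF this i] show ?thesis by (simp add: edge_label_top del: edge_label.simps)
  qed
  moreover have "v i = w i" if "i \<notin> {1..n}" for i
    using that assms row_order_perm_permutes by (simp add: permutes_not_in)
  ultimately show ?thesis by (metis ext)
qed

lemma nth_crossing_pairs:
  assumes k: "k < length cs" "cs ! k = (i, j)"
  shows "crossing_pairs (cell_letters cs) ! k
    = {edge_label n D (Left_Edge i j), edge_label n D (Top_Edge (Suc i) j)}"
proof -
  have mem: "(i, j) \<in> D" using k reads_row_order by (metis nth_mem reads_def)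
  then have ij: "1 \<le> i" "1 \<le> j" "i + j \<le> n" using D by (auto simp: triangle_def)
  \<comment> \<open>The cells read strictly before \<open>(i, j)\<close>; their word is the
    \<open>u\<close> of \<open>edge_label_out\<close>.\<close>
  let ?xs = "cells_above n D i @ row_cells n D i (Suc j)"
  obtain ys where ys: "cells_above n D (Suc i) = ?xs @ (i, j) # ys"
    using ij mem row_cells_split[of j n D i] by (auto simp: cells_above_Suc row_cells_Suc)
  obtain zs where "cs = cells_above n D (Suc i) @ zs"
  proof -
    have "[1..<Suc n] = [1..<Suc i] @ [Suc i..<Suc n]"
      using ij upt_add_eq_append[of 1 "Suc i" "n - i"] by simp
    then show ?thesis using that by (simp add: cs_def cells_above_def del: upt_Suc)
  qed
  with ys have cs: "cs = ?xs @ (i, j) # (ys @ zs)" by simp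
  have "length ?xs < length cs" by (subst cs) simp
  moreover have "cs ! length ?xs = (i, j)" by (subst cs) (rule nth_append_length)
  \<comment> \<open>A cell occurs only once in \<open>cs\<close>, so its index is the length of the
    prefix before it.\<close>
  ultimately have k_eq: "k = length ?xs"
    using nth_eq_iff_index_eq[OF reads_distinct[OF reads_row_order] k(1)] k(2) by metis
  have "cell_letters cs = cell_letters ?xs @ (i + j - 1) # cell_letters (ys @ zs)"
    by (subst cs) simp
  then have "crossing_pairs (cell_letters cs) ! k
      = word_perm (cell_letters ?xs) ` {i + j - 1, Suc (i + j - 1)}"
    using nth_crossing_pairs_append[of "cell_letters ?xs" "i + j - 1"]
    unfolding k_eq cell_letters_simps(4) by (simp only:)
  moreover have "Suc (i + j - 1) = i + j" using ij by simp
  moreover have "edge_label n D (Left_Edge i j) = word_perm (cell_letters ?xs) (i + j)"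
    and "edge_label n D (Top_Edge (Suc i) j) = word_perm (cell_letters ?xs) (i + j - 1)"
    using edge_label_out(3,4)[of i j n D] ij mem by simp_all
  ultimately show ?thesis by (simp only: image_insert image_empty insert_commute)
qed

text \<open>Pipes are replaced by their labels \<open>w p\<close> and \<open>w q\<close>, so
  crossing cells become the indices at which one fixed pair occurs in a list, and reducedness can
  become distinctness.\<close>

lemma crossings_eq:
  assumes pq: "p \<in> {1..n}" "q \<in> {1..n}"
  shows "crossings n D p q
    = (!) cs ` {k. k < length cs \<and> crossing_pairs (cell_letters cs) ! k = {w p, w q}}"
proof -
  let ?L = "\<lambda>c. edge_label n D (Left_Edge (fst c) (snd c))"
    and ?B = "\<lambda>c. edge_label n D (Top_Edge (Suc (fst c)) (snd c))"
  have mem: "c \<in> crossings n D p q \<longleftrightarrow> {?L c, ?B c} = {w p, w q}" if c: "c \<in> D" for c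
  proof -
    obtain i j where ij: "c = (i, j)" by fastforce
    have "valid_edge n (Left_Edge i j)" "valid_edge n (Top_Edge (Suc i) j)"
      using c D ij by (auto simp: triangle_def)
    note pipe = this[THEN edge_in_pipe_iff]
    show ?thesis using c unfolding crossings_def ij doubleton_eq_iff
      by (simp add: pipe[OF pq(1)] pipe[OF pq(2)] del: edge_label.simps)
  qed
  have nth: "crossing_pairs (cell_letters cs) ! k = {?L (cs ! k), ?B (cs ! k)}"
    if "k < length cs" for k
    by (rule nth_crossing_pairs[OF that]) simp
  have "crossings n D p q = {c \<in> D. {?L c, ?B c} = {w p, w q}}"
    using mem by (auto simp only: crossings_def)
  also have "\<dots> = (!) cs ` {k. k < length cs \<and> {?L (cs ! k), ?B (cs ! k)} = {w p, w q}}"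
  proof -
    have "D = (!) cs ` {k. k < length cs}" using reads_row_order by (auto simp: reads_def set_conv_nth)
    then show ?thesis by blast
  qed
  also have "\<dots> = (!) cs ` {k. k < length cs \<and> crossing_pairs (cell_letters cs) ! k = {w p, w q}}"
    using nth by (metis (no_types, lifting))
  finally show ?thesis .
qed

lemma reduced_iff_distinct:
  "reduced_pipe_dream n D \<longleftrightarrow> distinct (crossing_pairs (cell_letters cs))"
proof -
  let ?c = "crossing_pairs (cell_letters cs)"
  let ?K = "\<lambda>p q. {k. k < length cs \<and> ?c ! k = {w p, w q}}"
  have card: "card (crossings n D p q) = card (?K p q)"
    if "p \<in> {1..n}" "q \<in> {1..n}" "p \<noteq> q" for p q
    unfolding crossings_eq[OF that(1,2)]
    by (rule card_image) (use reads_distinct[OF reads_row_order] in \<open>auto simp: inj_on_def nth_eq_iff_index_eq\<close>)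
  have red: "reduced_pipe_dream n D \<longleftrightarrow> (\<forall>p\<in>{1..n}. \<forall>q\<in>{1..n}. p \<noteq> q \<longrightarrow> card (?K p q) \<le> 1)"
    using D card by (auto simp: reduced_pipe_dream_def triangle_def)
  show ?thesis
  proof
    assume dist: "distinct ?c"
    have "card (?K p q) \<le> 1" for p q
    proof (rule card_le_Suc0_iff_eq[THEN iffD2, simplified One_nat_def[symmetric]])
      show "\<forall>k\<in>?K p q. \<forall>l\<in>?K p q. k = l" using dist by (auto simp: nth_eq_iff_index_eq[symmetric])
    qed simp
    then show "reduced_pipe_dream n D" using red by blast
  next
    assume r: "reduced_pipe_dream n D"
    have "k = l" if kl: "k < length cs" "l < length cs" "?c ! k = ?c ! l" for k l
    proof -
      obtain i j where ij: "cs ! k = (i, j)" by fastforce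
      then have "(i, j) \<in> D" using kl reads_row_order by (metis nth_mem reads_def)
      then have pos: "i + j - 1 \<in> {1..n}" "Suc (i + j - 1) \<in> {1..n}" using D by (auto simp: triangle_def)
      let ?u = "word_perm (take k (cell_letters cs))"
      have ck: "?c ! k = ?u ` {i + j - 1, Suc (i + j - 1)}"
        using kl ij by (simp add: crossing_pairs_def cell_letters_def)
      have "set (cell_letters cs) \<subseteq> {1..n - 1}"
        using reads_row_order D by (fastforce simp: set_cell_letters triangle_def reads_def)
      then have u: "?u permutes {1..n}" by (intro word_perm_permutes) (meson set_take_subset subset_trans)
      \<comment> \<open>The pair at index \<open>k\<close> consists of values in
        \<open>{1..n}\<close>; their preimages under \<open>w\<close> are the two pipes that meet in
        cell \<open>k\<close>.\<close>
      define p q where "p = inv w (?u (i + j - 1))" and "q = inv w (?u (Suc (i + j - 1)))"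
      have "w p = ?u (i + j - 1)" "w q = ?u (Suc (i + j - 1))"
        by (simp_all add: p_def q_def permutes_inverses[OF row_order_perm_permutes])
      then have K: "k \<in> ?K p q" "l \<in> ?K p q" using kl ck by simp_all
      have "?u (i + j - 1) \<noteq> ?u (Suc (i + j - 1))" by (simp add: inj_eq[OF word_perm_inj])
      then have "p \<noteq> q" using \<open>w p = _\<close> \<open>w q = _\<close> by metis
      moreover have "p \<in> {1..n}" "q \<in> {1..n}"
        unfolding p_def q_def using pos permutes_in_image[OF u] permutes_in_image[OF permutes_inv[OF row_order_perm_permutes]]
        by blast+
      ultimately have "card (?K p q) \<le> Suc 0" using r[unfolded red] by simp
      moreover have "finite (?K p q)" by simp
      ultimately show "k = l" using K card_le_Suc0_iff_eq[of "?K p q"] by blast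
    qed
    then show "distinct ?c" by (simp add: distinct_conv_nth) blast
  qed
qed

end

lemma PD_imp_triangle: "D \<in> PD n w \<Longrightarrow> D \<subseteq> triangle n"
  by (auto simp: PD_def reduced_pipe_dream_def triangle_def)

text \<open>Product and length do not depend on the linear extension, so the row order used for the
  pipes may be replaced by any \<open>cs\<close>.\<close>

lemma PD_iff:
  assumes "D \<subseteq> triangle n" "reads D cs" "w permutes {1..n}"
  shows "D \<in> PD n w \<longleftrightarrow> w = word_perm (cell_letters cs) \<and> card (inversion_pairs w) = length cs"
proof -
  let ?ds = "cells_above n D (Suc n)"
  have sq: "D \<subseteq> {1..n} \<times> {1..n}" using assms(1) triangle_subset_square by blast
  note ds = reads_cells_above[OF sq]
  have "word_perm (cell_letters ?ds) = word_perm (cell_letters cs)"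
    by (rule reads_word_perm_unique[OF ds assms(2)]) (use sq in auto)
  moreover have "length ?ds = length cs" using length_reads[OF ds] length_reads[OF assms(2)] by simp
  ultimately show ?thesis
    using pipe_top_iff[OF assms(1,3)] reduced_iff_distinct[OF assms(1)]
      card_inversion_pairs_word_eq_iff[of "cell_letters ?ds"]
    by (auto simp: PD_def)
qed

section \<open>Lengths of fpf-involutions\<close>

text \<open>Distinct odd letters differ by at least two, so the transpositions are disjoint and the
  order of the letters is irrelevant.\<close>

lemma word_perm_odd_letters:
  assumes "distinct a" "\<forall>p\<in>set a. odd p"
  shows "word_perm a x
    = (if x \<in> set a then Suc x else if x \<noteq> 0 \<and> x - 1 \<in> set a then x - 1 else x)"
  using assms
proof (induction a)
  case (Cons p a)
  then have odd: "odd p" "p \<notin> set a" "\<forall>q\<in>set a. odd q" "distinct a" by auto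
  then obtain m where m: "p = 2 * m + 1" by (meson oddE)
  have "Suc p \<notin> set a" using odd(1,3) by (metis even_Suc)
  moreover have "2 * m \<notin> set a" using odd(3) by (metis dvd_triv_left)
  ultimately show ?case using Cons.IH[OF odd(4,3)] m odd(2)
    by (cases "x = p"; cases "x = Suc p") (auto simp: simple_transp_apply)
qed simp

lemma one_fpf_apply:
  "one_fpf n x = (if odd x \<and> x < n then Suc x else if x \<noteq> 0 \<and> even x \<and> x \<le> n then x - 1 else x)"
proof -
  have "one_fpf n x = (if x \<in> set (filter odd [1..<n]) then Suc x
      else if x \<noteq> 0 \<and> x - 1 \<in> set (filter odd [1..<n]) then x - 1 else x)"
    unfolding one_fpf_def by (rule word_perm_odd_letters) auto
  moreover have "x \<in> set (filter odd [1..<n]) \<longleftrightarrow> odd x \<and> x < n" by (auto simp: Suc_le_eq odd_pos)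
  moreover have "x \<noteq> 0 \<and> x - 1 \<in> set (filter odd [1..<n]) \<longleftrightarrow> x \<noteq> 0 \<and> even x \<and> x \<le> n"
    by (cases x) (auto simp: Suc_le_eq odd_pos)
  ultimately show ?thesis by (simp only:)
qed

lemma one_fpf_length_le: "length (filter odd [1..<n]) \<le> card (inversion_pairs (one_fpf n))"
proof -
  let ?f = "\<lambda>i. {i, Suc i}"
  have "length (filter odd [1..<n]) = card (set (filter odd [1..<n]))" by (simp add: distinct_card[symmetric] del: set_filter)
  also have "\<dots> = card (?f ` set (filter odd [1..<n]))"
    by (rule card_image[symmetric]) (auto simp: inj_on_def doubleton_eq_iff)
  also have "\<dots> \<le> card (inversion_pairs (one_fpf n))"
  proof (rule card_mono)
    show "?f ` set (filter odd [1..<n]) \<subseteq> inversion_pairs (one_fpf n)"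
    proof
      fix X assume "X \<in> ?f ` set (filter odd [1..<n])"
      then obtain i where i: "odd i" "i < n" "X = {i, Suc i}" by auto
      then have "one_fpf n i = Suc i" "one_fpf n (Suc i) = i" by (auto simp: one_fpf_apply)
      with i(3) show "X \<in> inversion_pairs (one_fpf n)" unfolding inversion_pairs_def
        by (intro CollectI exI[of _ i] exI[of _ "Suc i"]) auto
    qed
  qed (simp add: one_fpf_def)
  finally show ?thesis .
qed

lemma fpf_involutionsD:
  assumes "z \<in> fpf_involutions n"
  shows "z permutes {1..n}" "z (z i) = i" "i \<in> {1..n} \<Longrightarrow> z i \<noteq> i"
proof -
  show p: "z permutes {1..n}" and "i \<in> {1..n} \<Longrightarrow> z i \<noteq> i"
    using assms unfolding fpf_involutions_def by blast+
  have "z = inv z" using assms unfolding fpf_involutions_def by blast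
  then have "inv z = z" by (rule sym)
  then show "z (z i) = i" using permutes_inverses(1)[OF p, of i] by simp
qed

text \<open>The cycles are forced from the left: if \<open>1\<close> to \<open>2 * k\<close> are
  already paired among themselves, then \<open>2 * k + 1\<close> has a larger partner. Were this not
  its successor, a proper descent would have to occur on the way to the partner.\<close>

lemma fpf_no_proper_descent:
  assumes z: "z \<in> fpf_involutions n" and "even n"
    and desc: "\<And>p. p \<in> {1..n - 1} \<Longrightarrow> z (Suc p) < z p \<Longrightarrow> z p = Suc p"
  shows "z = one_fpf n"
proof -
  note zz = fpf_involutionsD[OF z]
  have mem: "z i \<in> {1..n}" if "i \<in> {1..n}" for i using permutes_in_image[OF zz(1)] that by blast
  have *: "2 * k + 2 \<le> n \<Longrightarrow> z (2 * k + 1) = 2 * k + 2" for k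
  proof (induction k rule: less_induct)
    case (less k)
    let ?a = "2 * k + 1"
    have small: "z x \<le> 2 * k" if x: "x \<in> {1..2 * k}" for x
    proof -
      define l where "l = (x - 1) div 2"
      have l: "l < k" "x = 2 * l + 1 \<or> x = 2 * l + 2" using x unfolding l_def by auto
      then have "z (2 * l + 1) = 2 * l + 2" using less by auto
      then show ?thesis using l zz(2)[of "2 * l + 1"] by auto
    qed
    have "z ?a \<ge> ?a"
    proof (rule ccontr)
      assume "\<not> z ?a \<ge> ?a"
      moreover have "z ?a \<in> {1..n}" using mem[of ?a] less.prems by auto
      ultimately have "z (z ?a) \<le> 2 * k" by (intro small) auto
      then show False using zz(2)[of ?a] by simp
    qed
    moreover have "z ?a \<noteq> ?a" using zz(3)[of ?a] less.prems by auto
    ultimately have gt: "?a < z ?a" by simp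
    show ?case
    proof (rule ccontr)
      assume ne: "z ?a \<noteq> 2 * k + 2"
      \<comment> \<open>On this interval an allowed descent at \<open>x\<close> needs
        \<open>z x = Suc x\<close>; with \<open>z ?a \<le> z x\<close> and \<open>x < z ?a\<close>
        this forces \<open>z x = z ?a\<close>, so \<open>x = ?a\<close>, which is excluded. At the
        right end, \<open>z (z ?a) = ?a\<close> then contradicts \<open>?a < z ?a\<close>.\<close>
      have "z ?a \<le> z x" if "?a \<le> x" "x \<le> z ?a" for x
        using that
      proof (induction x rule: dec_induct)
        case (step x)
        then have IH: "z ?a \<le> z x" by simp
        have "x \<in> {1..n - 1}" using step mem[of ?a] less.prems by auto
        moreover have "z x \<noteq> Suc x"
        proof
          assume "z x = Suc x"
          with IH step have "z x = z ?a" by simp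
          then have "x = ?a" using zz(2) by metis
          then show False using \<open>z x = Suc x\<close> ne by simp
        qed
        ultimately have "\<not> z (Suc x) < z x" using desc by blast
        then show ?case using IH by simp
      qed simp
      from this[of "z ?a"] gt show False using zz(2)[of ?a] by simp
    qed
  qed
  show ?thesis
  proof
    fix x
    consider "x \<notin> {1..n}" | "x \<in> {1..n}" "odd x" | "x \<in> {1..n}" "even x" by blast
    then show "z x = one_fpf n x"
    proof cases
      case 1
      then have "z x = x" using zz(1) by (simp add: permutes_not_in)
      with 1 show ?thesis by (auto simp: one_fpf_apply)
    next
      case 2
      then obtain k where k: "x = 2 * k + 1" by (meson oddE)
      have "x < n" using 2 \<open>even n\<close> by (auto simp: le_less)
      with 2 k *[of k] show ?thesis by (auto simp: one_fpf_apply)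
    next
      case 3
      then obtain m where m: "x = 2 * m" by (meson evenE)
      with 3 obtain k where "m = Suc k" by (cases m) auto
      with m have k: "x = 2 * k + 2" by simp
      with 3 * [of k] zz(2)[of "2 * k + 1"] show ?thesis by (auto simp: one_fpf_apply)
    qed
  qed
qed

lemma simple_transp_less_iff:
  assumes "{i, j} \<noteq> {p, Suc p}"
  shows "simple_transp p i < simple_transp p j \<longleftrightarrow> i < j"
  using assms by (auto simp: simple_transp_apply)

text \<open>Each conjugation at a proper descent removes two inversions and adds one letter to
  \<open>b\<close>; the process stops at \<open>one_fpf n\<close>.\<close>

lemma fpf_word_exists:
  assumes "z \<in> fpf_involutions n" "even n"
  shows "\<exists>b. set b \<subseteq> {1..n - 1} \<and> z = word_perm (rev b) \<circ> one_fpf n \<circ> word_perm b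
    \<and> 2 * length b + length (filter odd [1..<n]) \<le> card (inversion_pairs z)"
  using assms
proof (induction "card (inversion_pairs z)" arbitrary: z rule: less_induct)
  case less
  note zz = fpf_involutionsD[OF less.prems(1)]
  show ?case
  proof (cases "\<forall>p\<in>{1..n - 1}. z (Suc p) < z p \<longrightarrow> z p = Suc p")
    case True
    then have "z = one_fpf n" using fpf_no_proper_descent less.prems by blast
    then show ?thesis using one_fpf_length_le by (intro exI[of _ "[]"]) auto
  next
    case False
    then obtain p where p: "p \<in> {1..n - 1}" "z (Suc p) < z p" "z p \<noteq> Suc p" by blast
    let ?s = "simple_transp p"
    have s: "?s permutes {1..n}" by (rule simple_transp_permutes[OF p(1)])
    let ?v = "?s \<circ> z" and ?y = "?s \<circ> z \<circ> ?s"
    have v: "?v permutes {1..n}" by (rule permutes_compose[OF zz(1) s])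
    have y: "?y permutes {1..n}" by (rule permutes_compose[OF s v])
    have yfpf: "?y \<in> fpf_involutions n"
    proof -
      have "?y \<circ> ?y = id" using zz(2) by (simp add: fun_eq_iff)
      then have "?y = inv ?y" using inv_unique_comp by metis
      moreover have "?y i \<noteq> i" if "i \<in> {1..n}" for i
      proof
        assume "?y i = i"
        then have "z (?s i) = ?s i" by (metis comp_apply simple_transp_involutory)
        then show False using zz(3) permutes_in_image[OF s] that by metis
      qed
      ultimately show ?thesis using y unfolding fpf_involutions_def by blast
    qed
    have fin: "finite (inversion_pairs x)" if "x permutes {1..n}" for x
      using reduced_word_exists[OF that] by blast
    have "card (inversion_pairs z) = Suc (card (inversion_pairs (z \<circ> ?s)))"
      using inversion_pairs_descent[OF permutes_inj[OF zz(1)] p(2)]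
        fin[OF permutes_compose[OF s zz(1)]] by simp
    \<comment> \<open>\<open>z \<circ> ?s\<close> and \<open>?s \<circ> z\<close> are inverse to
      each other because \<open>z\<close> and \<open>?s\<close> are involutions.\<close>
    moreover have "card (inversion_pairs (z \<circ> ?s)) = card (inversion_pairs ?v)"
    proof -
      have "?v \<circ> (z \<circ> ?s) = id" "(z \<circ> ?s) \<circ> ?v = id" using zz(2) by (simp_all add: fun_eq_iff)
      then have "inv ?v = z \<circ> ?s" by (rule inv_unique_comp)
      then show ?thesis using card_inversion_pairs_inv[OF v] by simp
    qed
    moreover have "card (inversion_pairs ?v) = Suc (card (inversion_pairs ?y))"
    proof -
      have "p \<in> {1..n}" using p(1) by auto
      then have "z p \<noteq> p" by (rule zz(3))
      \<comment> \<open>As \<open>z p\<close> is neither \<open>p\<close> nor \<open>Suc p\<close>,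
        left multiplication by \<open>?s\<close> keeps the order of the two values, so the descent
        at \<open>p\<close> survives for the second drop.\<close>
      then have "{z (Suc p), z p} \<noteq> {p, Suc p}" using p(3) by (auto simp: doubleton_eq_iff)
      then have "?v (Suc p) < ?v p" using p(2) by (simp add: simple_transp_less_iff)
      note d = inversion_pairs_descent[OF permutes_inj[OF v] this]
      show ?thesis by (simp only: d(1) card_insert_disjoint[OF fin[OF y] d(2)])
    qed
    ultimately have drop: "card (inversion_pairs z) = card (inversion_pairs ?y) + 2" by simp
    then obtain b where b: "set b \<subseteq> {1..n - 1}" "?y = word_perm (rev b) \<circ> one_fpf n \<circ> word_perm b"
      "2 * length b + length (filter odd [1..<n]) \<le> card (inversion_pairs ?y)"
      using less.hyps[OF _ yfpf less.prems(2)] by auto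
    have "z = ?s \<circ> ?y \<circ> ?s" by (simp add: fun_eq_iff)
    then have "z = word_perm (rev (b @ [p])) \<circ> one_fpf n \<circ> word_perm (b @ [p])"
      unfolding b(2) by (simp add: fun_eq_iff)
    then show ?thesis using b drop p(1) by (intro exI[of _ "b @ [p]"]) auto
  qed
qed

section \<open>Involution words and pipe dreams for atoms\<close>

lemma letters_subset_imp_triangle:
  assumes "reads D cs" "D \<subseteq> {1..n} \<times> {1..n}" "n > 0"
  shows "set (cell_letters cs) \<subseteq> {1..n - 1} \<longleftrightarrow> D \<subseteq> triangle n"
  using assms by (fastforce simp: reads_def set_cell_letters triangle_def)

text \<open>Inside the staircase both sides say that the word is reduced with an fpf-atom as
  product; outside it both fail. The right side does not mention \<open>cs\<close>, which makes all
  reading words of \<open>D\<close> equivalent.\<close>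

lemma fpf_involution_word_iff_PD:
  assumes "reads D cs" "D \<subseteq> {1..n} \<times> {1..n}" "n > 0"
  shows "fpf_involution_word n z (cell_letters cs) \<longleftrightarrow> (\<exists>w. fpf_atom n z w \<and> D \<in> PD n w)"
proof (cases "D \<subseteq> triangle n")
  case True
  then have sub: "set (cell_letters cs) \<subseteq> {1..n - 1}" using letters_subset_imp_triangle[OF assms] by simp
  have "coxeter_length n (word_perm (cell_letters cs)) = card (inversion_pairs (word_perm (cell_letters cs)))"
    by (rule coxeter_length_eq_card[OF word_perm_permutes[OF sub]])
  moreover have "w permutes {1..n}" if "fpf_atom n z w" for w
    using that by (simp add: fpf_atom_def is_arg_min_def)
  ultimately show ?thesis
    using PD_iff[OF True assms(1)] sub unfolding fpf_involution_word_iff by auto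
next
  case False
  then have "\<not> set (cell_letters cs) \<subseteq> {1..n - 1}" using letters_subset_imp_triangle[OF assms] by simp
  then show ?thesis using False PD_imp_triangle unfolding fpf_involution_word_iff by blast
qed

text \<open>The word \<open>rev b\<close>, followed by the odd letters and \<open>b\<close>, bounds
  the inversions of \<open>z\<close> from above, and \<open>fpf_word_exists\<close> attains the
  bound. So the inversion count determines the minimal length.\<close>

lemma fpf_involution_word_iff_card:
  assumes "z \<in> fpf_involutions n" "even n" "set a \<subseteq> {1..n - 1}"
    and z: "z = word_perm (rev a) \<circ> one_fpf n \<circ> word_perm a"
  shows "fpf_involution_word n z a \<longleftrightarrow>
    card (inversion_pairs z) = 2 * length a + length (filter odd [1..<n])"
proof -
  have ge: "card (inversion_pairs z) \<le> 2 * length b + length (filter odd [1..<n])"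
    if "z = word_perm (rev b) \<circ> one_fpf n \<circ> word_perm b" for b
    using card_inversion_pairs_word_le[of "rev b @ filter odd [1..<n] @ b"] that
    by (simp add: one_fpf_def o_assoc)
  obtain b where b: "set b \<subseteq> {1..n - 1}" "z = word_perm (rev b) \<circ> one_fpf n \<circ> word_perm b"
    "2 * length b + length (filter odd [1..<n]) \<le> card (inversion_pairs z)"
    using fpf_word_exists[OF assms(1,2)] by blast
  have "fpf_involution_word n z a \<longleftrightarrow> (\<forall>b. set b \<subseteq> {1..n - 1} \<and>
      z = word_perm (rev b) \<circ> one_fpf n \<circ> word_perm b \<longrightarrow> length a \<le> length b)"
    using assms(3) z by (auto simp: fpf_involution_word_def is_arg_min_def not_less)
  also have "\<dots> \<longleftrightarrow> card (inversion_pairs z) = 2 * length a + length (filter odd [1..<n])"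
  proof
    assume "\<forall>b. set b \<subseteq> {1..n - 1} \<and>
      z = word_perm (rev b) \<circ> one_fpf n \<circ> word_perm b \<longrightarrow> length a \<le> length b"
    then have "length a \<le> length b" using b by blast
    then show "card (inversion_pairs z) = 2 * length a + length (filter odd [1..<n])"
      using b(3) ge[OF z] by linarith
  next
    assume c: "card (inversion_pairs z) = 2 * length a + length (filter odd [1..<n])"
    show "\<forall>b. set b \<subseteq> {1..n - 1} \<and>
      z = word_perm (rev b) \<circ> one_fpf n \<circ> word_perm b \<longrightarrow> length a \<le> length b"
      using ge c by fastforce
  qed
  finally show ?thesis .
qed

section \<open>Symmetric pipe dreams\<close>

definition diagonal_cells :: "nat list \<Rightarrow> (nat \<times> nat) list" where
  "diagonal_cells ks = map (\<lambda>k. (k, k)) ks"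

lemma cell_letters_diagonal: "cell_letters (diagonal_cells ks) = map (\<lambda>k. 2 * k - 1) ks"
  by (auto simp: cell_letters_def diagonal_cells_def)

lemma cell_letters_swap: "cell_letters (map prod.swap cs) = cell_letters cs"
  by (auto simp: cell_letters_def add.commute)

text \<open>Transposition reverses \<open>le_NE\<close>, so the reflected cells are listed
  backwards. \<open>le_NE\<close> never leads from a cell on or below the diagonal to one above it,
  nor from one below to one on it, and distinct diagonal cells are incomparable.\<close>

lemma reads_symmetric:
  assumes cs: "reads D cs" "D \<subseteq> strictly_lower n" and ks: "sorted_wrt (<) ks"
  shows "reads (D \<union> D\<inverse> \<union> (\<lambda>k. (k, k)) ` set ks)
    (map prod.swap (rev cs) @ diagonal_cells ks @ cs)"
proof -
  have lower: "j < i" if "(i, j) \<in> D" for i j using that cs(2) by (auto simp: strictly_lower_def)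
  have D: "set cs = D" using cs(1) by (simp add: reads_def)
  have "sorted_wrt (\<lambda>s t. \<not> le_NE t s) (map prod.swap (rev cs))"
    unfolding sorted_wrt_map sorted_wrt_rev
    using cs(1) by (auto simp: reads_def le_NE_def elim!: sorted_wrt_mono_rel[rotated])
  moreover have "sorted_wrt (\<lambda>s t. \<not> le_NE t s) (diagonal_cells ks)"
    unfolding sorted_wrt_map diagonal_cells_def
    by (rule sorted_wrt_mono_rel[OF _ ks]) (auto simp: le_NE_def)
  moreover have "\<forall>s\<in>set (map prod.swap (rev cs)). \<forall>t\<in>set (diagonal_cells ks @ cs). \<not> le_NE t s"
  proof (intro ballI)
    fix s t assume "s \<in> set (map prod.swap (rev cs))" "t \<in> set (diagonal_cells ks @ cs)"
    then have "fst s < snd s" "snd t \<le> fst t" using D lower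
      by (auto simp: diagonal_cells_def less_imp_le)
    then show "\<not> le_NE t s" by (simp add: le_NE_def)
  qed
  moreover have "\<forall>s\<in>set (diagonal_cells ks). \<forall>t\<in>set cs. \<not> le_NE t s"
  proof (intro ballI)
    fix s t assume "s \<in> set (diagonal_cells ks)" "t \<in> set cs"
    then have "fst s = snd s" "snd t < fst t" using D lower
      by (auto simp: diagonal_cells_def)
    then show "\<not> le_NE t s" by (simp add: le_NE_def)
  qed
  moreover have "sorted_wrt (\<lambda>s t. \<not> le_NE t s) cs" using cs(1) by (simp add: reads_def)
  ultimately have "sorted_wrt (\<lambda>s t. \<not> le_NE t s) (map prod.swap (rev cs) @ diagonal_cells ks @ cs)"
    unfolding sorted_wrt_append by blast
  moreover have "set (map prod.swap (rev cs) @ diagonal_cells ks @ cs) = D \<union> D\<inverse> \<union> (\<lambda>k. (k, k)) ` set ks"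
  proof -
    have "prod.swap ` D = D\<inverse>" by force
    then show ?thesis using D by (auto simp: diagonal_cells_def)
  qed
  ultimately show ?thesis by (simp add: reads_def)
qed

lemma sym_decompose:
  assumes "sym E" "E \<subseteq> triangle n"
  shows "E = (E \<inter> strictly_lower n) \<union> (E \<inter> strictly_lower n)\<inverse>
    \<union> (\<lambda>k. (k, k)) ` set (filter (\<lambda>k. (k, k) \<in> E) [1..<Suc n])"
proof (intro equalityI subsetI)
  fix c assume c: "c \<in> E"
  obtain i j where ij: "c = (i, j)" by fastforce
  then have rng: "i \<in> {1..n}" "j \<in> {1..n}" using c assms(2) by (auto simp: triangle_def)
  have "(j, i) \<in> E" using assms(1) c ij by (auto dest: symD)
  then show "c \<in> (E \<inter> strictly_lower n) \<union> (E \<inter> strictly_lower n)\<inverse>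
    \<union> (\<lambda>k. (k, k)) ` set (filter (\<lambda>k. (k, k) \<in> E) [1..<Suc n])"
    using c ij rng by (cases i j rule: linorder_cases) (auto simp: strictly_lower_def simp del: upt_Suc)
next
  fix c assume "c \<in> (E \<inter> strictly_lower n) \<union> (E \<inter> strictly_lower n)\<inverse>
    \<union> (\<lambda>k. (k, k)) ` set (filter (\<lambda>k. (k, k) \<in> E) [1..<Suc n])"
  then show "c \<in> E" using assms(1) by (auto dest: symD)
qed

text \<open>These are the letters of the cells \<open>(k, k)\<close> with
  \<open>2 * k \<le> n\<close>, the full diagonal of the staircase.\<close>

lemma half_diagonal_letters:
  assumes "even n"
  shows "set (map (\<lambda>k. 2 * k - 1) [1..<Suc (n div 2)]) = set (filter odd [1..<n])"
proof -
  have "\<exists>k\<in>{1..<Suc (n div 2)}. p = 2 * k - 1" if "odd p" "p < n" for p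
  proof -
    from that obtain m where "p = 2 * m + 1" by (meson oddE)
    then show ?thesis using that by (intro bexI[of _ "Suc m"]) auto
  qed
  then show ?thesis by (auto simp del: upt_Suc)
qed

lemma word_perm_half_diagonal:
  assumes "even n"
  shows "word_perm (map (\<lambda>k. 2 * k - 1) [1..<Suc (n div 2)]) = one_fpf n"
    and "length (filter odd [1..<n]) = n div 2"
proof -
  let ?d = "map (\<lambda>k. 2 * k - 1) [1..<Suc (n div 2)]" and ?o = "filter odd [1..<n]"
  note eq = half_diagonal_letters[OF assms]
  have d: "distinct ?d" by (auto simp: distinct_map inj_on_def simp del: upt_Suc)
  have odd: "\<forall>p\<in>set ?d. odd p" by (subst eq) simp
  show "word_perm ?d = one_fpf n"
  proof
    fix x
    have "\<forall>p\<in>set ?o. odd p" "distinct ?o" by simp_all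
    then show "word_perm ?d x = one_fpf n x" unfolding one_fpf_def
      by (simp only: word_perm_odd_letters[OF d odd] word_perm_odd_letters[of ?o] eq)
  qed
  show "length ?o = n div 2"
    using distinct_card[OF d] distinct_card[of ?o] eq by (simp del: upt_Suc set_map set_filter)
qed

text \<open>A missing cell \<open>(k, k)\<close> leaves \<open>2 * k - 1\<close> unmoved by the
  middle part of the product, and conjugation turns it into a fixed point of \<open>z\<close> in
  \<open>{1..n}\<close>. As an equality of lists the result can be substituted in
  \<open>sym_decompose\<close>.\<close>

lemma fpf_symmetric_PD_diagonal:
  assumes z: "z \<in> fpf_involutions n" "even n" and E: "E \<in> PD n z" "sym E"
  shows "filter (\<lambda>k. (k, k) \<in> E) [1..<Suc n] = [1..<Suc (n div 2)]"
proof -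
  let ?ks = "filter (\<lambda>k. (k, k) \<in> E) [1..<Suc n]"
  let ?D = "E \<inter> strictly_lower n"
  have tri: "E \<subseteq> triangle n" by (rule PD_imp_triangle[OF E(1)])
  have "?D \<subseteq> {1..n} \<times> {1..n}" using tri triangle_subset_square by blast
  from reads_cells_above[OF this] obtain cs where cs: "reads ?D cs" by blast
  have "reads E (map prod.swap (rev cs) @ diagonal_cells ?ks @ cs)"
    using reads_symmetric[OF cs, of n ?ks] sym_decompose[OF E(2) tri]
    by (simp add: sorted_wrt_filter del: upt_Suc)
  from PD_iff[OF tri this fpf_involutionsD(1)[OF z(1)]] E(1)
  have zeq: "z = word_perm (rev (cell_letters cs)) \<circ> word_perm (map (\<lambda>k. 2 * k - 1) ?ks)
      \<circ> word_perm (cell_letters cs)"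
    by (simp add: cell_letters_swap rev_map[symmetric] cell_letters_diagonal o_assoc)
  have diag: "(k, k) \<in> E" if k: "k \<in> {1..n div 2}" for k
  proof (rule ccontr)
    assume notin: "(k, k) \<notin> E"
    \<comment> \<open>Chosen so that the rightmost factor of \<open>z\<close> sends it to
      \<open>2 * k - 1\<close>.\<close>
    let ?x = "word_perm (rev (cell_letters cs)) (2 * k - 1)"
    have "word_perm (map (\<lambda>k. 2 * k - 1) ?ks) (2 * k - 1) = 2 * k - 1"
    proof (rule word_perm_fixes, intro ballI)
      fix q assume "q \<in> set (map (\<lambda>k. 2 * k - 1) ?ks)"
      then obtain l where "q = 2 * l - 1" "l \<ge> 1" "l \<noteq> k" using notin by (auto simp del: upt_Suc)
      then show "2 * k - 1 \<noteq> q \<and> 2 * k - 1 \<noteq> Suc q" using k by auto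
    qed
    then have fixed: "z ?x = ?x"
      by (simp add: zeq word_perm_rev_apply del: upt_Suc)
    have "set (cell_letters cs) \<subseteq> {1..n - 1}"
      using cs tri by (fastforce simp: reads_def set_cell_letters triangle_def)
    then have "word_perm (rev (cell_letters cs)) permutes {1..n}" by (intro word_perm_permutes) simp
    then have "?x \<in> {1..n}" using permutes_in_image k by fastforce
    then show False using fixed fpf_involutionsD(3)[OF z(1)] by blast
  qed
  have "[1..<Suc n] = [1..<Suc (n div 2)] @ [Suc (n div 2)..<Suc n]"
    using upt_add_eq_append[of 1 "Suc (n div 2)" "n - n div 2"] by simp
  moreover have "filter (\<lambda>k. (k, k) \<in> E) [1..<Suc (n div 2)] = [1..<Suc (n div 2)]"
    using diag by (simp add: filter_id_conv del: upt_Suc)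
  moreover have "filter (\<lambda>k. (k, k) \<in> E) [Suc (n div 2)..<Suc n] = []"
    using tri by (auto simp: filter_empty_conv triangle_def simp del: upt_Suc)
  ultimately show ?thesis by (simp del: upt_Suc)
qed

text \<open>Since the diagonal is forced, only one symmetric set can witness membership in
  \<open>FD n z\<close>. Its reading word has the product and length that
  \<open>fpf_involution_word_iff_card\<close> asks for.\<close>

lemma FD_iff_fpf_involution_word:
  assumes z: "z \<in> fpf_involutions n" "even n" and cs: "reads D cs" "D \<subseteq> strictly_lower n"
  shows "D \<in> FD n z \<longleftrightarrow> fpf_involution_word n z (cell_letters cs)"
proof -
  let ?ks = "[1..<Suc (n div 2)]"
  let ?E = "D \<union> D\<inverse> \<union> (\<lambda>k. (k, k)) ` set ?ks"
  let ?es = "map prod.swap (rev cs) @ diagonal_cells ?ks @ cs"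
  let ?a = "cell_letters cs"
  have reads: "reads ?E ?es" by (rule reads_symmetric[OF cs]) (simp del: upt_Suc)
  have word: "word_perm (cell_letters ?es) = word_perm (rev ?a) \<circ> one_fpf n \<circ> word_perm ?a"
    using word_perm_half_diagonal(1)[OF z(2)]
    by (simp add: cell_letters_swap rev_map[symmetric] cell_letters_diagonal o_assoc del: upt_Suc)
  have len: "length ?es = 2 * length ?a + length (filter odd [1..<n])"
    using word_perm_half_diagonal(2)[OF z(2)] by (simp add: diagonal_cells_def del: upt_Suc)
  have lower: "?E \<inter> strictly_lower n = D" using cs(2) by (auto simp: strictly_lower_def)
  have symE: "sym ?E" by (auto simp: sym_def)
  have E_iff: "D \<in> FD n z \<longleftrightarrow> ?E \<in> PD n z"
  proof
    assume "D \<in> FD n z"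
    then obtain F where F: "F \<in> PD n z" "sym F" "D = F \<inter> strictly_lower n" by (auto simp: FD_def)
    have "F = ?E"
      by (rule sym_decompose[OF F(2) PD_imp_triangle[OF F(1)],
            unfolded fpf_symmetric_PD_diagonal[OF z F(1,2)] F(3)[symmetric]])
    with F(1) show "?E \<in> PD n z" by (simp only:)
  next
    assume "?E \<in> PD n z"
    then show "D \<in> FD n z" unfolding FD_def using symE lower[symmetric] by blast
  qed
  have tri: "set ?a \<subseteq> {1..n - 1} \<longleftrightarrow> ?E \<subseteq> triangle n"
  proof -
    \<comment> \<open>The added diagonal cells have \<open>k \<le> n div 2\<close>, so they lie in
      the staircase whatever \<open>D\<close> is.\<close>
    have "D \<subseteq> triangle n \<longleftrightarrow> ?E \<subseteq> triangle n"
      using cs(2) by (auto simp: triangle_def simp del: upt_Suc)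
    moreover have "set ?a \<subseteq> {1..n - 1} \<longleftrightarrow> D \<subseteq> triangle n"
      using cs by (fastforce simp: reads_def set_cell_letters triangle_def strictly_lower_def)
    ultimately show ?thesis by simp
  qed
  show ?thesis
  proof (cases "?E \<subseteq> triangle n")
    case True
    then have sub: "set ?a \<subseteq> {1..n - 1}" using tri by simp
    have "?E \<in> PD n z \<longleftrightarrow> z = word_perm (rev ?a) \<circ> one_fpf n \<circ> word_perm ?a
        \<and> card (inversion_pairs z) = 2 * length ?a + length (filter odd [1..<n])"
      by (simp only: PD_iff[OF True reads fpf_involutionsD(1)[OF z(1)]] word len)
    also have "\<dots> \<longleftrightarrow> fpf_involution_word n z ?a"
      using fpf_involution_word_iff_card[OF z sub]
      by (auto simp: fpf_involution_word_def is_arg_min_def)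
    finally show ?thesis using E_iff by simp
  next
    case False
    then have "\<not> fpf_involution_word n z ?a"
      using tri by (auto simp: fpf_involution_word_def is_arg_min_def)
    then show ?thesis using E_iff PD_imp_triangle False by blast
  qed
qed

theorem theorem3p12:
  fixes n :: nat and z :: "nat \<Rightarrow> nat" and D :: "(nat \<times> nat) set"
  assumes "n > 0" and "even n"
    and "z \<in> fpf_involutions n"
    and "D \<subseteq> {1..n} \<times> {1..n}"
  shows "((\<exists>a. reading_word n D a \<and> fpf_involution_word n z a) \<longleftrightarrow>
          (\<forall>a. reading_word n D a \<longrightarrow> fpf_involution_word n z a))
       \<and> ((\<forall>a. reading_word n D a \<longrightarrow> fpf_involution_word n z a) \<longleftrightarrow>
          (\<exists>w. fpf_atom n z w \<and> D \<in> PD n w))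
       \<and> (D \<subseteq> strictly_lower n \<longrightarrow>
          (D \<in> FD n z \<longleftrightarrow> (\<exists>w. fpf_atom n z w \<and> D \<in> PD n w)))"
proof -
  have word: "fpf_involution_word n z a \<longleftrightarrow> (\<exists>w. fpf_atom n z w \<and> D \<in> PD n w)"
    if "reading_word n D a" for a
    using reading_word_imp_reads[OF that assms(4)] fpf_involution_word_iff_PD[OF _ assms(4,1)] by blast
  obtain a where "reading_word n D a" using reading_word_exists by blast
  \<comment> \<open>Both conditions are compared with the word read in row order.\<close>
  moreover have "D \<in> FD n z \<longleftrightarrow> (\<exists>w. fpf_atom n z w \<and> D \<in> PD n w)" if "D \<subseteq> strictly_lower n"
    using reads_cells_above[OF assms(4)] FD_iff_fpf_involution_word[OF assms(3,2) _ that]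
      fpf_involution_word_iff_PD[OF _ assms(4,1)] by blast
  ultimately show ?thesis using word by blast
qed

end
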